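(* Let $g_1(n)$ be defined by $$(-q,-q^{4};q^{5})_{\infty}^{2}(q^{4},q^{6};q^{10})_{\infty}=\sum_{n=0}^{\infty}g_{1}(n)q^{n}.$$ Then for any integer $n\geq0$: $g_{1}(5n)>0$; $g_{1}(5n+1)>0$; $g_{1}(5n+2)>0$; and $g_{1}(5n+4)>0$ provided $n\neq1$.
   Context: Notation: for $|q|<1$, $(a;q)_{\infty}:=\prod_{n=0}^{\infty}(1-aq^{n})$ and $(a_{1},\ldots,a_{m};q)_{\infty}:=(a_{1};q)_{\infty}\cdots(a_{m};q)_{\infty}$; similarly with $q$ replaced by $q^k$ in the base. *)

theory Defs
  imports "HOL-Analysis.Analysis"
begin

text \<open>
  The infinite \<open>q\<close>-Pochhammer symbol \<open>(a; q)\<^sub>\<infinity>\<close>. It is meaningful for \<open>norm q < 1\<close>, where the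
  product converges; vanishing factors are unproblematic, since \<^const>\<open>prodinf\<close> admits them.
\<close>
definition qpochhammer_inf :: "'a :: {real_normed_field, banach} \<Rightarrow> 'a \<Rightarrow> 'a" where
  "qpochhammer_inf a q = (\<Prod>n. 1 - a * q ^ n)"

text \<open>The multi-parameter version \<open>(a\<^sub>1, \<dots>, a\<^sub>m; q)\<^sub>\<infinity>\<close>.\<close>
definition qpochhammer_infs :: "'a :: {real_normed_field, banach} list \<Rightarrow> 'a \<Rightarrow> 'a" where
  "qpochhammer_infs as q = (\<Prod>a\<leftarrow>as. qpochhammer_inf a q)"

end

theory Submission
  imports Defs
begin

text \<open>
  Write \<open>[z] = (z, p/z; p)\<^sub>\<infinity>\<close> with \<open>p = Q\<^sup>1\<^sup>0\<close> and \<open>Q = q\<^sup>5\<close>. The product \<open>G(q)\<close> in question has the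
  5-dissection
    \<open>G(q) = [-Q][-Q\<^sup>4] / ([Q][Q\<^sup>2]\<^sup>2[Q\<^sup>4]) + 2q / ([Q][Q\<^sup>2]\<^sup>2[Q\<^sup>3][Q\<^sup>4])
            + q\<^sup>2 [-Q][-Q\<^sup>4] / ([Q][Q\<^sup>2][Q\<^sup>4]\<^sup>2) + q\<^sup>4 [-Q\<^sup>2][-Q\<^sup>3] / ([Q\<^sup>2][Q\<^sup>3][Q\<^sup>4]\<^sup>2)\<close>
  (theorem \<open>product_dissection\<close>), from which the signs can be read off. Every \<open>[-Q\<^sup>a]\<close> and every
  \<open>1/[Q\<^sup>a]\<close> with \<open>0 < a < 10\<close> expands with nonnegative coefficients and constant term 1. In the
  components of \<open>q\<^sup>0\<close>, \<open>q\<^sup>1\<close> and \<open>q\<^sup>2\<close> the factor \<open>1/(1 - Q)\<close> of \<open>1/[Q]\<close> makes all coefficients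
  positive. In the component of \<open>q\<^sup>4\<close> the corresponding factor is \<open>1/((1 - Q\<^sup>2)(1 - Q\<^sup>3))\<close>, and the
  numbers \<open>2i + 3j\<close> are exactly the natural numbers other than 1.

  For the dissection, \<open>G(q)\<close> times the power series \<open>(Q;Q)\<^sub>\<infinity>\<^sup>2 (Q\<^sup>2;Q\<^sup>2)\<^sub>\<infinity>\<close> in \<open>Q\<close> is, by the Jacobi triple
  product, a product of three theta series of the form \<open>\<theta>(z; r) = \<Sum>\<^sub>n z\<^sup>n r\<^bsup>n\<^sup>2\<^esup>\<close>. Two of them are equal, and
  splitting \<open>\<int>\<^sup>2\<close> by the parity of the coordinate sum turns their product into two products of thetas
  (\<open>theta_mult_parity\<close>) in each of which one factor depends on \<open>Q\<close> only. The other factor is multiplied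
  with the third theta series. There the exponent of \<open>q\<close> modulo 5 is an isotropic linear form, so that \<open>\<int>\<^sup>2\<close>
  splits into five translates of a lattice which is again an orthogonal sum of two lines
  (\<open>theta_mult_quintic\<close>); each residue class contributes products of two thetas in \<open>Q\<close>.

  After this, every component is a difference of two products of brackets. Up to common factors, each of
  these differences is one side of an instance of Weierstrass' three-term relation
  (\<open>mtheta_three_term\<close>), and hence a single product. The three-term relation itself is the Pluecker
  relation for the vectors of thetas that the parity splitting produces.

  All identities are needed for real \<open>0 < q < 1\<close> only, because a power series is determined by its
  values there (\<open>power_series_unique\<close>).
\<close>

section \<open>Infinite products\<close>

lemma abs_convergent_qpoch:
  fixes a q :: "'a :: {real_normed_field, banach}"
  assumes "norm q < 1"
  shows "abs_convergent_prod (\<lambda>n. 1 - a * q ^ n)"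
  unfolding abs_convergent_prod_conv_summable
  using assms by (simp add: norm_mult norm_power summable_geometric)

lemma convergent_qpoch:
  fixes a q :: "'a :: {real_normed_field, banach}"
  assumes "norm q < 1"
  shows "convergent_prod (\<lambda>n. 1 - a * q ^ n)"
  using abs_convergent_qpoch[OF assms] by (rule abs_convergent_prod_imp_convergent_prod)

lemma LIMSEQ_qpoch:
  fixes a q :: "'a :: {real_normed_field, banach}"
  assumes "norm q < 1"
  shows "(\<lambda>N. \<Prod>n<N. 1 - a * q ^ n) \<longlonglongrightarrow> qpochhammer_inf a q"
proof -
  have "(\<lambda>N. \<Prod>n\<le>N. 1 - a * q ^ n) \<longlonglongrightarrow> qpochhammer_inf a q"
    unfolding qpochhammer_inf_def using convergent_prod_LIMSEQ convergent_qpoch[OF assms] by blast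
  then have "(\<lambda>N. \<Prod>n<Suc N. 1 - a * q ^ n) \<longlonglongrightarrow> qpochhammer_inf a q"
    by (simp add: lessThan_Suc_atMost)
  then show ?thesis by (rule LIMSEQ_imp_Suc)
qed

lemma qpoch_nonzero:
  fixes a q :: "'a :: {real_normed_field, banach}"
  assumes "norm q < 1" "norm a < 1"
  shows "qpochhammer_inf a q \<noteq> 0"
  unfolding qpochhammer_inf_def
proof (rule prodinf_nonzero[OF convergent_qpoch[OF assms(1)]])
  fix i
  have "norm (a * q ^ i) \<le> norm a * 1"
    unfolding norm_mult norm_power using assms by (intro mult_left_mono power_le_one) auto
  then have "norm (a * q ^ i) < 1" using assms by simp
  then show "1 - a * q ^ i \<noteq> 0" by auto
qed

lemma of_real_qpoch:
  fixes a q :: real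
  assumes "norm q < 1"
  shows "complex_of_real (qpochhammer_inf a q) = qpochhammer_inf (of_real a) (of_real q)"
proof (rule LIMSEQ_unique)
  show "(\<lambda>N. \<Prod>n<N. 1 - of_real a * of_real q ^ n) \<longlonglongrightarrow> qpochhammer_inf (of_real a) (complex_of_real q)"
    by (rule LIMSEQ_qpoch) (use assms in simp)
  show "(\<lambda>N. \<Prod>n<N. 1 - of_real a * of_real q ^ n) \<longlonglongrightarrow> complex_of_real (qpochhammer_inf a q)"
    using tendsto_of_real[OF LIMSEQ_qpoch[OF assms, of a], where 'a = complex] by simp
qed

text \<open>
  Factor \<open>n = i + k m\<close> goes to the \<open>i\<close>-th product on the right; on finite products of length \<open>k N\<close> this is
  mere regrouping.
\<close>
lemma qpoch_multisection:
  fixes a q :: "'a :: {real_normed_field, banach}"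
  assumes "norm q < 1" "k > 0"
  shows "qpochhammer_inf a q = (\<Prod>i<k. qpochhammer_inf (a * q ^ i) (q ^ k))"
proof (rule LIMSEQ_unique)
  have "strict_mono (\<lambda>N. N * k)" using assms by (simp add: strict_mono_def)
  from LIMSEQ_subseq_LIMSEQ[OF LIMSEQ_qpoch[OF assms(1), of a] this]
  show "(\<lambda>N. \<Prod>n<N * k. 1 - a * q ^ n) \<longlonglongrightarrow> qpochhammer_inf a q" by (simp add: o_def)
  have k: "norm (q ^ k) < 1"
    unfolding norm_power using assms by (simp add: power_less_one_iff)
  have "(\<Prod>n<N * k. 1 - a * q ^ n) = (\<Prod>i<k. \<Prod>n<N. 1 - a * q ^ i * (q ^ k) ^ n)" for N
  proof -
    have "(\<Prod>n<N * k. 1 - a * q ^ n) = (\<Prod>n<N. \<Prod>i<k. 1 - a * q ^ (i + n * k))"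
    proof -
      have "(\<Prod>n=m * k..<m * k + k. 1 - a * q ^ n) = (\<Prod>i<k. 1 - a * q ^ (i + m * k))" for m
        using prod.shift_bounds_nat_ivl[of "\<lambda>n. 1 - a * q ^ n" 0 "m * k" k]
        by (simp add: lessThan_atLeast0 add.commute)
      then show ?thesis by (simp add: prod.nat_group[symmetric])
    qed
    also have "\<dots> = (\<Prod>i<k. \<Prod>n<N. 1 - a * q ^ (i + n * k))" by (rule prod.swap)
    finally show ?thesis by (simp add: power_add power_mult mult_ac flip: power_mult)
  qed
  then show "(\<lambda>N. \<Prod>n<N * k. 1 - a * q ^ n) \<longlonglongrightarrow> (\<Prod>i<k. qpochhammer_inf (a * q ^ i) (q ^ k))"
    by (simp only:) (intro tendsto_prod LIMSEQ_qpoch[OF k])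
qed

lemma qpoch_mult_uminus:
  fixes a q :: "'a :: {real_normed_field, banach}"
  assumes "norm q < 1"
  shows "qpochhammer_inf a q * qpochhammer_inf (- a) q = qpochhammer_inf (a\<^sup>2) (q\<^sup>2)"
proof (rule LIMSEQ_unique)
  have q2: "norm (q\<^sup>2) < 1"
    unfolding norm_power using assms by (simp add: power_less_one_iff)
  show "(\<lambda>N. (\<Prod>n<N. 1 - a * q ^ n) * (\<Prod>n<N. 1 - (- a) * q ^ n)) \<longlonglongrightarrow> qpochhammer_inf a q * qpochhammer_inf (- a) q"
    by (intro tendsto_mult LIMSEQ_qpoch assms)
  have "(\<Prod>n<N. 1 - a * q ^ n) * (\<Prod>n<N. 1 - (- a) * q ^ n) = (\<Prod>n<N. 1 - a\<^sup>2 * (q\<^sup>2) ^ n)" for N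
    unfolding prod.distrib[symmetric] by (intro prod.cong) (auto simp: algebra_simps power2_eq_square power_mult_distrib)
  then show "(\<lambda>N. (\<Prod>n<N. 1 - a * q ^ n) * (\<Prod>n<N. 1 - (- a) * q ^ n)) \<longlonglongrightarrow> qpochhammer_inf (a\<^sup>2) (q\<^sup>2)"
    using LIMSEQ_qpoch[OF q2] by simp
qed

lemma qpoch_rec:
  fixes a q :: "'a :: {real_normed_field, banach}"
  assumes "norm q < 1"
  shows "qpochhammer_inf a q = (1 - a) * qpochhammer_inf (a * q) q"
proof (rule LIMSEQ_unique)
  show "(\<lambda>N. \<Prod>n<Suc N. 1 - a * q ^ n) \<longlonglongrightarrow> qpochhammer_inf a q"
    using LIMSEQ_qpoch[OF assms] by (rule LIMSEQ_Suc)
  show "(\<lambda>N. \<Prod>n<Suc N. 1 - a * q ^ n) \<longlonglongrightarrow> (1 - a) * qpochhammer_inf (a * q) q"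
    unfolding prod.lessThan_Suc_shift using LIMSEQ_qpoch[OF assms, of "a * q"]
    by (auto intro!: tendsto_mult simp: mult_ac)
qed


section \<open>The Jacobi triple product\<close>

fun gauss_binomial :: "'a :: comm_ring_1 \<Rightarrow> nat \<Rightarrow> nat \<Rightarrow> 'a" where
  "gauss_binomial q n 0 = 1"
| "gauss_binomial q 0 (Suc k) = 0"
| "gauss_binomial q (Suc n) (Suc k) = gauss_binomial q n k + q ^ Suc k * gauss_binomial q n (Suc k)"

lemma gauss_binomial_eq_0: "n < k \<Longrightarrow> gauss_binomial q n k = 0"
  by (induction q n k rule: gauss_binomial.induct) auto

text \<open>
  Removing the first factor replaces \<open>w\<close> by \<open>w q\<close>, which is what the recursion of the Gaussian
  binomials encodes.
\<close>
lemma q_binomial_theorem: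
  "(\<Prod>i<n. 1 + w * q ^ i) = (\<Sum>k\<le>n. q ^ (k choose 2) * gauss_binomial q n k * w ^ k)"
proof (induction n arbitrary: w)
  case (Suc n)
  let ?g = "gauss_binomial q"
  have "(\<Prod>i<Suc n. 1 + w * q ^ i) = (1 + w) * (\<Prod>i<n. 1 + (w * q) * q ^ i)"
    by (subst prod.lessThan_Suc_shift) (simp add: mult_ac)
  also have "\<dots> = (1 + w) * (\<Sum>k\<le>n. q ^ (k choose 2) * ?g n k * (w * q) ^ k)"
    by (simp only: Suc.IH)
  also have "\<dots> = (\<Sum>k\<le>n. q ^ (k choose 2) * ?g n k * (w * q) ^ k) +
                  (\<Sum>k\<le>n. w * (q ^ (k choose 2) * ?g n k * (w * q) ^ k))"
    by (subst distrib_right) (simp only: sum_distrib_left mult_1)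
  also have "(\<Sum>k\<le>n. q ^ (k choose 2) * ?g n k * (w * q) ^ k) =
             (\<Sum>k\<le>Suc n. q ^ (k choose 2) * ?g n k * (w * q) ^ k)"
    by (simp add: gauss_binomial_eq_0)
  also have "\<dots> = 1 + (\<Sum>k\<le>n. q ^ (Suc k choose 2) * ?g n (Suc k) * (w * q) ^ Suc k)"
    by (subst sum.atMost_Suc_shift) (simp add: numeral_2_eq_2)
  also have "1 + (\<Sum>k\<le>n. q ^ (Suc k choose 2) * ?g n (Suc k) * (w * q) ^ Suc k) +
      (\<Sum>k\<le>n. w * (q ^ (k choose 2) * ?g n k * (w * q) ^ k)) =
      1 + (\<Sum>k\<le>n. q ^ (Suc k choose 2) * ?g (Suc n) (Suc k) * w ^ Suc k)"
    by (simp add: sum.distrib[symmetric] numeral_2_eq_2 algebra_simps power_add power_mult_distrib)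
  also have "\<dots> = (\<Sum>k\<le>Suc n. q ^ (k choose 2) * ?g (Suc n) k * w ^ k)"
    unfolding sum.atMost_Suc_shift[of _ n] by (simp add: binomial_eq_0)
  finally show ?case .
qed (simp add: binomial_eq_0)

text \<open>
  The closed form \<open>(q;q)\<^sub>n / ((q;q)\<^sub>k (q;q)\<^bsub>n-k\<^esub>)\<close>, cleared of denominators so that it holds in any
  commutative ring.
\<close>
lemma gauss_binomial_prod:
  assumes "k \<le> n"
  shows "gauss_binomial q n k * ((\<Prod>i<k. 1 - q * q ^ i) * (\<Prod>i<n - k. 1 - q * q ^ i)) = (\<Prod>i<n. 1 - q * q ^ i)"
  using assms
proof (induction q n k rule: gauss_binomial.induct)
  case (3 q n k)
  define A where "A = (\<Prod>i<k. 1 - q * q ^ i)"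
  have A: "(\<Prod>i<Suc k. 1 - q * q ^ i) = A * (1 - q ^ Suc k)" by (simp add: A_def)
  have n: "(\<Prod>i<Suc n. 1 - q * q ^ i) = (\<Prod>i<n. 1 - q * q ^ i) * (1 - q ^ Suc n)" by simp
  have IH1: "gauss_binomial q n k * (A * (\<Prod>i<n - k. 1 - q * q ^ i)) = (\<Prod>i<n. 1 - q * q ^ i)"
    using 3 by (simp add: A_def)
  show ?case
  proof (cases "k = n")
    case True
    then show ?thesis using IH1 by (simp add: A_def gauss_binomial_eq_0 mult.assoc[symmetric])
  next
    case False
    then obtain d where d: "n = k + Suc d" using 3 by (metis Suc_le_mono le_neq_implies_less less_iff_Suc_add add_Suc_right)
    define B where "B = (\<Prod>i<d. 1 - q * q ^ i)"
    have B: "(\<Prod>i<Suc d. 1 - q * q ^ i) = B * (1 - q ^ Suc d)" by (simp add: B_def)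
    have IH2: "gauss_binomial q n (Suc k) * ((A * (1 - q ^ Suc k)) * B) = (\<Prod>i<n. 1 - q * q ^ i)"
      using 3 d by (simp add: A_def B_def)
    have IH1': "gauss_binomial q n k * (A * (B * (1 - q ^ Suc d))) = (\<Prod>i<n. 1 - q * q ^ i)"
      using IH1 d B by simp
    have "(gauss_binomial q n k + q ^ Suc k * gauss_binomial q n (Suc k)) * ((A * (1 - q ^ Suc k)) * (B * (1 - q ^ Suc d)))
      = (1 - q ^ Suc k) * (gauss_binomial q n k * (A * (B * (1 - q ^ Suc d))))
       + q ^ Suc k * (1 - q ^ Suc d) * (gauss_binomial q n (Suc k) * ((A * (1 - q ^ Suc k)) * B))"
      by (simp only: algebra_simps)
    also have "\<dots> = (\<Prod>i<n. 1 - q * q ^ i) * (1 - q ^ Suc n)"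
      unfolding IH1' IH2 by (simp add: d algebra_simps power_add)
    finally show ?thesis using d B A n by (simp only: gauss_binomial.simps) simp
  qed
qed auto

text \<open>
  In Ramanujan's notation, \<open>f(a, b)\<close> is \<open>theta z r\<close> with \<open>a = z r\<close> and \<open>b = r / z\<close>. Letting the exponent be the
  full square \<open>n\<^sup>2\<close> makes products of theta series sums over the quadratic form \<open>m\<^sup>2 + n\<^sup>2\<close>.
\<close>
definition theta :: "real \<Rightarrow> real \<Rightarrow> real" where
  "theta z r = (\<Sum>\<^sub>\<infinity>n::int. z powi n * r powi (n * n))"

text \<open>
  Tannery's theorem for sums over the integers, obtained from the one for series through an enumeration
  of \<open>\<int>\<close>. The approximating sums are finite, which is the situation in the triple product.
\<close>
lemma tannery_int:
  fixes f :: "nat \<Rightarrow> int \<Rightarrow> real"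
  assumes fin: "\<And>N. finite {n. f N n \<noteq> 0}"
    and lim: "\<And>n. (\<lambda>N. f N n) \<longlonglongrightarrow> g n"
    and bound: "\<And>N n. \<bar>f N n\<bar> \<le> M n"
    and M: "M summable_on UNIV"
  shows "(\<lambda>N. \<Sum>n | f N n \<noteq> 0. f N n) \<longlonglongrightarrow> (\<Sum>\<^sub>\<infinity>n. g n)"
proof -
  have bij: "bij_betw int_decode UNIV UNIV" by (rule bij_int_decode)
  have "(\<lambda>k. M (int_decode k)) summable_on UNIV"
    using M summable_on_reindex_bij_betw[OF bij, of M] by simp
  then have sM: "summable (\<lambda>k. M (int_decode k))" by (rule summable_on_imp_summable)
  have T: "summable (\<lambda>k. norm (g (int_decode k))) \<and>
     (\<lambda>N. \<Sum>k. f N (int_decode k)) \<longlonglongrightarrow> (\<Sum>k. g (int_decode k))"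
    using tannerys_theorem[of "\<lambda>k N. f N (int_decode k)" "\<lambda>k. g (int_decode k)" sequentially
        "\<lambda>k. M (int_decode k)"] lim sM bound
    by (auto intro!: always_eventually)
  have "((\<lambda>k. g (int_decode k)) has_sum (\<Sum>k. g (int_decode k))) UNIV"
    using T by (intro norm_summable_imp_has_sum) (auto intro!: summable_sums summable_norm_cancel[of "\<lambda>k. g (int_decode k)"])
  then have g: "(\<Sum>k. g (int_decode k)) = (\<Sum>\<^sub>\<infinity>n. g n)"
    using has_sum_reindex_bij_betw[OF bij, of g] infsumI by metis
  have f: "(\<Sum>k. f N (int_decode k)) = (\<Sum>n | f N n \<noteq> 0. f N n)" for N
  proof -
    have "(f N has_sum (\<Sum>n | f N n \<noteq> 0. f N n)) UNIV"
      by (rule has_sum_finite_neutralI[OF fin]) auto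
    then have "((\<lambda>k. f N (int_decode k)) has_sum (\<Sum>n | f N n \<noteq> 0. f N n)) UNIV"
      using has_sum_reindex_bij_betw[OF bij, of "f N"] by simp
    then show ?thesis using has_sum_imp_sums sums_unique by metis
  qed
  show ?thesis using T unfolding g f by simp
qed

lemma summable_quadratic_power:
  fixes c r :: real
  assumes "0 < r" "r < 1" "0 < c"
  shows "summable (\<lambda>n. c ^ n * r ^ (n * n))"
proof (rule summable_comparison_test_ev)
  have "(\<lambda>n. c * r ^ n) \<longlonglongrightarrow> c * 0"
    by (intro tendsto_mult tendsto_const LIMSEQ_realpow_zero) (use assms in auto)
  then have "eventually (\<lambda>n. c * r ^ n < 1/2) sequentially"
    by (rule order_tendstoD) auto
  then show "eventually (\<lambda>n. norm (c ^ n * r ^ (n * n)) \<le> (1/2) ^ n) sequentially"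
  proof eventually_elim
    case (elim n)
    have "norm (c ^ n * r ^ (n * n)) = (c * r ^ n) ^ n"
      using assms by (simp add: power_mult_distrib power_mult)
    also have "\<dots> \<le> (1/2) ^ n" using elim assms by (intro power_mono) auto
    finally show ?case .
  qed
  show "summable (\<lambda>n. (1/2::real) ^ n)" by simp
qed

lemma theta_abs_summable:
  fixes z r :: real
  assumes "0 < r" "r < 1" "z \<noteq> 0"
  shows "(\<lambda>n::int. norm (z powi n * r powi (n * n))) summable_on UNIV"
proof -
  let ?f = "\<lambda>n::int. norm (z powi n * r powi (n * n))"
  have nat: "(\<lambda>n::nat. c ^ n * r ^ (n * n)) summable_on UNIV" if "c > 0" for c
    using summable_quadratic_power[OF assms(1,2) that] assms that
    by (subst summable_on_UNIV_nonneg_real_iff) auto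
  have "(\<lambda>n::nat. ?f (int n)) summable_on UNIV"
    using nat[of "\<bar>z\<bar>"] assms
    by (simp add: abs_mult power_int_def nat_mult_distrib power_abs)
  then have 1: "?f summable_on range int"
    by (subst summable_on_reindex) (auto simp: o_def)
  have "?f (- int n) = (1 / \<bar>z\<bar>) ^ n * r ^ (n * n)" for n
    using assms by (simp add: abs_mult power_int_minus power_int_of_nat divide_inverse power_abs power_inverse
      flip: of_nat_mult)
  then have "(\<lambda>n::nat. ?f (- int n)) summable_on UNIV"
    using nat[of "1 / \<bar>z\<bar>"] assms by simp
  then have 2: "?f summable_on range (\<lambda>n. - int n)"
    by (subst summable_on_reindex) (auto simp: o_def inj_def)
  have "range int \<union> range (\<lambda>n. - int n) = UNIV"
    by (metis (no_types, lifting) UNIV_eq_I UnCI int_cases2 rangeI)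
  then show ?thesis using summable_on_union[OF 1 2] by simp
qed

lemma theta_summable:
  fixes z r :: real
  assumes "0 < r" "r < 1" "z \<noteq> 0"
  shows "(\<lambda>n::int. z powi n * r powi (n * n)) summable_on UNIV"
  using theta_abs_summable[OF assms] by (rule abs_summable_summable)

text \<open>
  The \<open>q\<close>-binomial theorem with \<open>2N\<close> factors, centred: for \<open>w = z r\<^bsup>1-2N\<^esup>\<close> the second half of the factors
  is \<open>1 + z r\<^bsup>2i+1\<^esup>\<close>, and the first half, read backwards and after extracting \<open>z r\<^bsup>-(2i+1)\<^esup>\<close>, is
  \<open>1 + r\<^bsup>2i+1\<^esup>/z\<close>.
\<close>
lemma finite_triple_product:
  fixes z r :: real
  assumes "z \<noteq> 0" "r > 0"
  shows "(\<Prod>i<N. (1 + z * r * (r\<^sup>2) ^ i) * (1 + r / z * (r\<^sup>2) ^ i)) =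
    (\<Sum>k\<le>2 * N. gauss_binomial (r\<^sup>2) (2 * N) k * (z powi (int k - int N) * r powi ((int k - int N) * (int k - int N))))"
proof -
  \<comment> \<open>the shift that centres the \<open>2N\<close> exponents at 0\<close>
  define w where "w = z * r powi (1 - 2 * int N)"
  have A: "(\<Prod>i<2 * N. 1 + w * (r\<^sup>2) ^ i) = 
     z ^ N * r powi (- (int N * int N)) * (\<Prod>i<N. (1 + z * r * (r\<^sup>2) ^ i) * (1 + r / z * (r\<^sup>2) ^ i))"
  proof -
    have "(\<Prod>i<2 * N. 1 + w * (r\<^sup>2) ^ i) = (\<Prod>i<N. 1 + w * (r\<^sup>2) ^ i) * (\<Prod>i<N. 1 + w * (r\<^sup>2) ^ (N + i))"
    proof -
      have "{..<2 * N} = {..<N} \<union> {N..<2 * N}" by auto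
      then have "(\<Prod>i<2 * N. 1 + w * (r\<^sup>2) ^ i) = (\<Prod>i<N. 1 + w * (r\<^sup>2) ^ i) * (\<Prod>i=N..<2 * N. 1 + w * (r\<^sup>2) ^ i)"
        by (simp add: prod.union_disjoint ivl_disj_int)
      also have "(\<Prod>i=N..<2 * N. 1 + w * (r\<^sup>2) ^ i) = (\<Prod>i<N. 1 + w * (r\<^sup>2) ^ (N + i))"
        using prod.shift_bounds_nat_ivl[of "\<lambda>i. 1 + w * (r\<^sup>2) ^ i" 0 N N]
        by (simp add: lessThan_atLeast0 mult_2 add.commute)
      finally show ?thesis .
    qed
    also have "(\<Prod>i<N. 1 + w * (r\<^sup>2) ^ (N + i)) = (\<Prod>i<N. 1 + z * r * (r\<^sup>2) ^ i)"
    proof (intro prod.cong refl)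
      fix i
      have "w * (r\<^sup>2) ^ (N + i) = z * (r powi (1 - 2 * int N) * r powi (2 * int (N + i)))"
        by (simp add: w_def power_int_def power_mult[symmetric] nat_mult_distrib nat_add_distrib)
      also have "r powi (1 - 2 * int N) * r powi (2 * int (N + i)) = r powi int (1 + 2 * i)"
        using assms by (subst power_int_add[symmetric]) auto
      also have "z * \<dots> = z * r * (r\<^sup>2) ^ i" by (simp only: power_int_of_nat power_add power_mult) simp
      finally show "1 + w * (r\<^sup>2) ^ (N + i) = 1 + z * r * (r\<^sup>2) ^ i" by simp
    qed
    also have "(\<Prod>i<N. 1 + w * (r\<^sup>2) ^ i) = (\<Prod>i<N. 1 + w * (r\<^sup>2) ^ (N - Suc i))"
      by (rule prod.nat_diff_reindex[symmetric])
    also have "\<dots> = (\<Prod>i<N. (z * r powi (- int (1 + 2 * i))) * (1 + r / z * (r\<^sup>2) ^ i))"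
    proof (intro prod.cong refl)
      fix i assume i: "i \<in> {..<N}"
      have "w * (r\<^sup>2) ^ (N - Suc i) = z * (r powi (1 - 2 * int N) * r powi (int (2 * (N - Suc i))))"
        unfolding power_int_of_nat by (simp add: w_def power_mult)
      also have "r powi (1 - 2 * int N) * r powi (int (2 * (N - Suc i))) = r powi (- int (1 + 2 * i))"
        using assms i by (subst power_int_add[symmetric]) (auto simp: of_nat_diff)
      finally have *: "w * (r\<^sup>2) ^ (N - Suc i) = z * r powi (- int (1 + 2 * i))" .
      have "r / z * (r\<^sup>2) ^ i = r powi (int (1 + 2 * i)) / z"
        unfolding power_int_of_nat by (simp add: power_mult)
      then have "(z * r powi (- int (1 + 2 * i))) * (r / z * (r\<^sup>2) ^ i) = 1"
        using assms by (simp only: power_int_minus) simp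
      then show "1 + w * (r\<^sup>2) ^ (N - Suc i) = (z * r powi (- int (1 + 2 * i))) * (1 + r / z * (r\<^sup>2) ^ i)"
        by (simp add: * ring_distribs)
    qed
    also have "\<dots> = (\<Prod>i<N. z * r powi (- int (1 + 2 * i))) * (\<Prod>i<N. 1 + r / z * (r\<^sup>2) ^ i)"
      by (rule prod.distrib)
    also have "(\<Prod>i<N. z * r powi (- int (1 + 2 * i))) = z ^ N * r powi (- (int N * int N))"
    proof (induction N)
      case (Suc N)
      have "r powi (- (int N * int N)) * r powi (- int (1 + 2 * N)) = r powi (- (int (Suc N) * int (Suc N)))"
        using assms by (subst power_int_add[symmetric]) (auto simp: algebra_simps)
      then show ?case using Suc by (simp add: mult_ac)
    qed auto
    finally show ?thesis by (simp add: prod.distrib mult_ac)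
  qed
  have B: "(r\<^sup>2) ^ (k choose 2) * w ^ k =
     z ^ N * r powi (- (int N * int N)) * (z powi (int k - int N) * r powi ((int k - int N) * (int k - int N)))" for k
  proof -
    have e: "2 * int (k choose 2) = int k * (int k - 1)"
    proof -
      have "even (k * (k - 1))" by (cases k) auto
      then have "2 * (k choose 2) = k * (k - 1)" unfolding choose_two by (rule dvd_mult_div_cancel)
      then have "int (2 * (k choose 2)) = int (k * (k - 1))" by simp
      then show ?thesis by (cases k) (auto simp: algebra_simps)
    qed
    have "(r\<^sup>2) ^ (k choose 2) * w ^ k = (r\<^sup>2) ^ (k choose 2) * (z ^ k * (r powi (1 - 2 * int N)) ^ k)"
      by (simp add: w_def power_mult_distrib)
    also have "(r powi (1 - 2 * int N)) ^ k = r powi ((1 - 2 * int N) * int k)"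
      by (simp add: power_int_mult)
    also have r2: "(r\<^sup>2) ^ (k choose 2) = r powi (2 * int (k choose 2))"
      by (simp add: power_int_mult)
    also have "z ^ k = z ^ N * z powi (int k - int N)"
      using assms by (simp add: power_int_diff)
    also have "r powi (2 * int (k choose 2)) * (z ^ N * z powi (int k - int N) * r powi ((1 - 2 * int N) * int k))
      = z ^ N * z powi (int k - int N) * r powi (2 * int (k choose 2) + (1 - 2 * int N) * int k)"
      using assms by (simp add: power_int_add)
    also have "2 * int (k choose 2) + (1 - 2 * int N) * int k = - (int N * int N) + (int k - int N) * (int k - int N)"
      unfolding e by (simp add: algebra_simps)
    also have "r powi \<dots> = r powi (- (int N * int N)) * r powi ((int k - int N) * (int k - int N))"
      using assms by (intro power_int_add) auto
    finally show ?thesis by (simp only: r2 mult_ac)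
  qed
  have "z ^ N * r powi (- (int N * int N)) * (\<Prod>i<N. (1 + z * r * (r\<^sup>2) ^ i) * (1 + r / z * (r\<^sup>2) ^ i))
     = (\<Sum>k\<le>2 * N. (r\<^sup>2) ^ (k choose 2) * gauss_binomial (r\<^sup>2) (2 * N) k * w ^ k)"
    unfolding A[symmetric] by (rule q_binomial_theorem)
  also have "\<dots> = (\<Sum>k\<le>2 * N. gauss_binomial (r\<^sup>2) (2 * N) k * ((r\<^sup>2) ^ (k choose 2) * w ^ k))"
    by (simp add: mult_ac)
  also have "\<dots> = z ^ N * r powi (- (int N * int N)) * (\<Sum>k\<le>2 * N. gauss_binomial (r\<^sup>2) (2 * N) k * (z powi (int k - int N) * r powi ((int k - int N) * (int k - int N))))"
    unfolding B sum_distrib_left by (simp add: mult_ac)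
  finally show ?thesis using assms by simp
qed

lemma qpoch_bounds:
  fixes q :: real
  assumes "0 < q" "q < 1"
  shows "0 < qpochhammer_inf q q"
    "qpochhammer_inf q q \<le> (\<Prod>i<n. 1 - q * q ^ i)" "(\<Prod>i<n. 1 - q * q ^ i) \<le> 1"
proof -
  have f: "0 < 1 - q * q ^ i" "1 - q * q ^ i \<le> 1" for i
    using assms power_less_one_iff[of q "Suc i"] by auto
  show "0 < qpochhammer_inf q q" unfolding qpochhammer_inf_def
    by (intro less_0_prodinf convergent_qpoch) (use assms f in auto)
  show "(\<Prod>i<n. 1 - q * q ^ i) \<le> 1" by (intro prod_le_1) (use f in \<open>auto intro: less_imp_le\<close>)
  have "decseq (\<lambda>n. \<Prod>i<n. 1 - q * q ^ i)"
  proof (rule decseq_SucI)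
    fix n
    have "(\<Prod>i<n. 1 - q * q ^ i) \<ge> 0" using f by (intro prod_nonneg) (auto intro: less_imp_le)
    then show "(\<Prod>i<Suc n. 1 - q * q ^ i) \<le> (\<Prod>i<n. 1 - q * q ^ i)"
      using f[of n] by (simp add: mult_left_le)
  qed
  then show "qpochhammer_inf q q \<le> (\<Prod>i<n. 1 - q * q ^ i)"
    using decseq_ge[OF _ LIMSEQ_qpoch] assms by force
qed

lemma gauss_binomial_eq:
  fixes q :: real
  assumes "0 < q" "q < 1" "k \<le> n"
  shows "gauss_binomial q n k = (\<Prod>i<n. 1 - q * q ^ i) / ((\<Prod>i<k. 1 - q * q ^ i) * (\<Prod>i<n - k. 1 - q * q ^ i))"
proof -
  have "(\<Prod>i<m. 1 - q * q ^ i) > 0" for m using qpoch_bounds[OF assms(1,2)] by (meson less_le_trans)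
  then have "(\<Prod>i<k. 1 - q * q ^ i) * (\<Prod>i<n - k. 1 - q * q ^ i) \<noteq> 0" by (metis less_irrefl mult_eq_0_iff)
  then show ?thesis using gauss_binomial_prod[OF assms(3), of q] by (simp add: eq_divide_eq)
qed

text \<open>
  The upper bound is uniform in \<open>n\<close> and \<open>k\<close>; it provides the dominating series for the limit in the triple
  product.
\<close>
lemma gauss_binomial_bounds:
  fixes q :: real
  assumes "0 < q" "q < 1"
  shows "0 \<le> gauss_binomial q n k" "gauss_binomial q n k \<le> 1 / (qpochhammer_inf q q * qpochhammer_inf q q)"
proof -
  show "0 \<le> gauss_binomial q n k" 
    using assms by (induction q n k rule: gauss_binomial.induct) auto
  note b = qpoch_bounds[OF assms]
  show "gauss_binomial q n k \<le> 1 / (qpochhammer_inf q q * qpochhammer_inf q q)"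
  proof (cases "k \<le> n")
    case True
    show ?thesis unfolding gauss_binomial_eq[OF assms True]
      using b by (intro frac_le mult_mono mult_pos_pos) (auto intro: less_imp_le order.trans)
  next
    case False
    then show ?thesis using b(1) by (simp add: gauss_binomial_eq_0)
  qed
qed

text \<open>
  Let \<open>N\<close> tend to infinity in the finite version. The centred Gaussian binomial coefficients tend to
  \<open>1/(r\<^sup>2;r\<^sup>2)\<^sub>\<infinity>\<close> and are bounded, so Tannery's theorem permits the limit to be taken termwise.
\<close>
theorem jacobi_triple_product:
  fixes z r :: real
  assumes "0 < r" "r < 1" "z \<noteq> 0"
  shows "theta z r = qpochhammer_inf (- z * r) (r\<^sup>2) * qpochhammer_inf (- r / z) (r\<^sup>2) * qpochhammer_inf (r\<^sup>2) (r\<^sup>2)"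
proof -
  let ?q = "r\<^sup>2"
  have q: "0 < ?q" "?q < 1" using assms by (auto simp: power_less_one_iff)
  let ?P = "qpochhammer_inf ?q ?q"
  note b = qpoch_bounds[OF q]
  define t where "t n = z powi n * r powi (n * n)" for n
  \<comment> \<open>the cut-off matters only for \<open>n < -N\<close>, where truncation to \<open>nat\<close> would give the binomial coefficient the value 1\<close>
  define f where "f N n = (if \<bar>n\<bar> \<le> int N then gauss_binomial ?q (2 * N) (nat (int N + n)) * t n else 0)" for N n
  have fin: "finite {n. f N n \<noteq> 0}" for N
    by (rule finite_subset[of _ "{- int N..int N}"]) (auto simp: f_def split: if_splits)
  have sum: "(\<Sum>n | f N n \<noteq> 0. f N n) = (\<Prod>i<N. (1 + z * r * (r\<^sup>2) ^ i) * (1 + r / z * (r\<^sup>2) ^ i))" for N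
  proof -
    have "(\<Sum>n | f N n \<noteq> 0. f N n) = (\<Sum>n\<in>{- int N..int N}. f N n)"
      by (rule sum.mono_neutral_left) (auto simp: f_def split: if_splits)
    also have "\<dots> = (\<Sum>k\<le>2 * N. f N (int k - int N))"
      by (rule sum.reindex_bij_witness[where i = "\<lambda>k. int k - int N" and j = "\<lambda>n. nat (int N + n)"]) auto
    also have "\<dots> = (\<Sum>k\<le>2 * N. gauss_binomial ?q (2 * N) k * t (int k - int N))"
      by (intro sum.cong) (auto simp: f_def)
    finally show ?thesis unfolding t_def using finite_triple_product[of z r N] assms by simp
  qed
  have lim: "(\<lambda>N. f N n) \<longlonglongrightarrow> t n / ?P" for n
  proof -
    let ?p = "\<lambda>n. \<Prod>i<n. 1 - ?q * ?q ^ i"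
    have p: "?p \<longlonglongrightarrow> ?P" by (rule LIMSEQ_qpoch) (use q in auto)
    have p2: "(\<lambda>N. ?p (g N)) \<longlonglongrightarrow> ?P" if "filterlim g at_top sequentially" for g
      using filterlim_compose[OF p that] .
    have "(\<lambda>N. ?p (2 * N) / (?p (nat (int N + n)) * ?p (nat (int N - n))) * t n) \<longlonglongrightarrow> ?P / (?P * ?P) * t n"
    proof (intro tendsto_intros p2)
      show "filterlim (\<lambda>N::nat. 2 * N) at_top sequentially"
        unfolding filterlim_at_top eventually_sequentially
      proof (intro allI)
        fix Z :: nat show "\<exists>M. \<forall>N\<ge>M. Z \<le> 2 * N" by (rule exI[of _ Z]) auto
      qed
      show "filterlim (\<lambda>N. nat (int N + n)) at_top sequentially"
        unfolding filterlim_at_top eventually_sequentially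
      proof (intro allI)
        fix Z :: nat show "\<exists>M. \<forall>N\<ge>M. Z \<le> nat (int N + n)" by (rule exI[of _ "Z + nat \<bar>n\<bar>"]) auto
      qed
      show "filterlim (\<lambda>N. nat (int N - n)) at_top sequentially"
        unfolding filterlim_at_top eventually_sequentially
      proof (intro allI)
        fix Z :: nat show "\<exists>M. \<forall>N\<ge>M. Z \<le> nat (int N - n)" by (rule exI[of _ "Z + nat \<bar>n\<bar>"]) auto
      qed
      show "?P * ?P \<noteq> 0" using b(1) by simp
    qed
    moreover have "\<forall>\<^sub>F N in sequentially. ?p (2 * N) / (?p (nat (int N + n)) * ?p (nat (int N - n))) * t n = f N n"
      unfolding eventually_sequentially
    proof (intro exI[of _ "nat \<bar>n\<bar>"] allI impI)
      fix N assume N: "nat \<bar>n\<bar> \<le> N"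
      then have 1: "nat (int N + n) \<le> 2 * N" and 2: "\<bar>n\<bar> \<le> int N" by auto
      have 3: "2 * N - nat (int N + n) = nat (int N - n)" using N by auto
      show "?p (2 * N) / (?p (nat (int N + n)) * ?p (nat (int N - n))) * t n = f N n"
        using gauss_binomial_eq[OF q 1] 2 3 by (simp add: f_def)
    qed
    ultimately have "(\<lambda>N. f N n) \<longlonglongrightarrow> ?P / (?P * ?P) * t n" by (rule Lim_transform_eventually)
    then show ?thesis using b(1) by simp
  qed
  have bound: "\<bar>f N n\<bar> \<le> 1 / (?P * ?P) * \<bar>t n\<bar>" for N n
  proof (cases "\<bar>n\<bar> \<le> int N")
    case True
    then have "\<bar>f N n\<bar> = gauss_binomial ?q (2 * N) (nat (int N + n)) * \<bar>t n\<bar>"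
      using gauss_binomial_bounds(1)[OF q] by (simp add: f_def abs_mult)
    also have "\<dots> \<le> 1 / (?P * ?P) * \<bar>t n\<bar>"
      by (rule mult_right_mono[OF gauss_binomial_bounds(2)[OF q]]) simp
    finally show ?thesis .
  next
    case False
    then show ?thesis using b(1) by (simp add: f_def)
  qed
  have M: "(\<lambda>n. 1 / (?P * ?P) * \<bar>t n\<bar>) summable_on UNIV"
    using theta_abs_summable[OF assms] by (intro summable_on_cmult_right) (simp add: t_def)
  from tannery_int[OF fin lim bound M]
  have "(\<lambda>N. (\<Prod>i<N. (1 + z * r * (r\<^sup>2) ^ i) * (1 + r / z * (r\<^sup>2) ^ i))) \<longlonglongrightarrow> (\<Sum>\<^sub>\<infinity>n. t n / ?P)"
    unfolding sum .
  moreover have "(\<lambda>N. (\<Prod>i<N. (1 + z * r * (r\<^sup>2) ^ i) * (1 + r / z * (r\<^sup>2) ^ i))) \<longlonglongrightarrow> 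
      qpochhammer_inf (- z * r) (r\<^sup>2) * qpochhammer_inf (- r / z) (r\<^sup>2)"
    unfolding prod.distrib
    using tendsto_mult[OF LIMSEQ_qpoch LIMSEQ_qpoch, of ?q ?q "- z * r" "- r / z"] q by simp
  ultimately have "(\<Sum>\<^sub>\<infinity>n. t n / ?P) = qpochhammer_inf (- z * r) (r\<^sup>2) * qpochhammer_inf (- r / z) (r\<^sup>2)"
    by (rule LIMSEQ_unique)
  moreover have "(\<Sum>\<^sub>\<infinity>n. t n / ?P) = theta z r / ?P"
    unfolding theta_def t_def divide_inverse by (rule infsum_cmult_left')
  ultimately show ?thesis using b(1) by (simp add: field_simps)
qed

section \<open>Products of two theta series\<close>

lemma theta_inverse: "theta (1 / z) r = theta z r"
proof -
  have b: "bij_betw (uminus :: int \<Rightarrow> int) UNIV UNIV"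
    by (rule bij_betwI[of _ _ _ uminus]) auto
  show ?thesis unfolding theta_def
    by (subst infsum_reindex_bij_betw[OF b, symmetric])
       (auto intro!: infsum_cong simp: power_int_minus power_int_divide_distrib field_simps)
qed

lemma theta_shift:
  assumes "z \<noteq> 0" "r \<noteq> 0"
  shows "theta (z * r\<^sup>2) r = theta z r / (z * r)"
proof -
  have b: "bij_betw (\<lambda>n::int. n + 1) UNIV UNIV"
    by (rule bij_betwI[of _ _ _ "\<lambda>n. n - 1"]) auto
  have "theta z r = (\<Sum>\<^sub>\<infinity>n::int. z powi (n + 1) * r powi ((n + 1) * (n + 1)))"
    unfolding theta_def by (subst infsum_reindex_bij_betw[OF b, symmetric]) simp
  also have "\<dots> = (\<Sum>\<^sub>\<infinity>n::int. z * r * ((z * r\<^sup>2) powi n * r powi (n * n)))"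
  proof (intro infsum_cong)
    fix n :: int
    have "r powi ((n + 1) * (n + 1)) = r powi (n * n) * r powi (2 * n) * r"
      using assms by (subst power_int_add[symmetric], simp, subst power_int_add_1[symmetric])
        (simp_all add: algebra_simps)
    moreover have "(r\<^sup>2) powi n = r powi (2 * n)" by (simp add: power_int_mult)
    ultimately show "z powi (n + 1) * r powi ((n + 1) * (n + 1)) = z * r * ((z * r\<^sup>2) powi n * r powi (n * n))"
      using assms by (simp add: power_int_add_1 power_int_mult_distrib)
  qed
  also have "\<dots> = z * r * theta (z * r\<^sup>2) r"
    unfolding theta_def by (rule infsum_cmult_right')
  finally show ?thesis using assms by simp
qed

text \<open>
  The quasi-period maps \<open>-1/r\<close> to \<open>-r\<close> with multiplier \<open>-1\<close>, whereas inversion maps it to \<open>-r\<close> with multiplier 1.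
\<close>
lemma theta_eq_0:
  assumes "r \<noteq> 0"
  shows "theta (- r) r = 0"
proof -
  have "theta (- (1 / r) * r\<^sup>2) r = theta (- (1 / r)) r / (- (1 / r) * r)"
    by (rule theta_shift) (use assms in auto)
  moreover have "- (1 / r) * r\<^sup>2 = - r" using assms by (simp add: power2_eq_square)
  moreover have "theta (- (1 / r)) r = theta (- r) r"
    using theta_inverse[of "- r" r] by simp
  ultimately show ?thesis using assms by simp
qed

lemma theta_mult:
  assumes "0 < r" "r < 1" "z \<noteq> 0" "w \<noteq> 0"
  shows "((\<lambda>(m, n). z powi m * r powi (m * m) * (w powi n * r powi (n * n))) has_sum (theta z r * theta w r)) UNIV"
proof -
  let ?f = "\<lambda>m::int. z powi m * r powi (m * m)" and ?g = "\<lambda>n::int. w powi n * r powi (n * n)"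
  have f: "(?f has_sum theta z r) UNIV" and g: "(?g has_sum theta w r) UNIV"
    unfolding theta_def by (intro has_sum_infsum theta_summable; use assms in auto)+
  have "(\<lambda>x. norm ((\<lambda>(m, n). ?f m * ?g n) x)) summable_on UNIV \<times> UNIV"
  proof (rule Infinite_Sum.abs_summable_on_Sigma_iff[THEN iffD2], intro conjI ballI)
    fix m :: int
    show "(\<lambda>n. norm ((\<lambda>(m, n). ?f m * ?g n) (m, n))) summable_on UNIV"
      using summable_on_cmult_right[OF theta_abs_summable[of r w], of "norm (?f m)"] assms
      by (simp only: prod.case norm_mult[of "?f m"]) simp
    have "(\<Sum>\<^sub>\<infinity>n. norm ((\<lambda>(m, n). ?f m * ?g n) (m, n))) = norm (?f m) * (\<Sum>\<^sub>\<infinity>n. norm (?g n))" for m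
      by (simp only: prod.case norm_mult[of "?f m"]) (rule infsum_cmult_right')
    then show "(\<lambda>m. norm (\<Sum>\<^sub>\<infinity>n. norm ((\<lambda>(m, n). ?f m * ?g n) (m, n)))) summable_on UNIV"
      using theta_abs_summable[of r z] assms
      by (simp only: norm_mult[of "norm _"]) (intro summable_on_cmult_left, simp)
  qed
  then have s: "(\<lambda>(m, n). ?f m * ?g n) summable_on UNIV \<times> UNIV"
    by (rule Infinite_Sum.abs_summable_summable)
  have "((\<lambda>(m, n). ?f m * ?g n) has_sum (theta z r * theta w r)) (UNIV \<times> UNIV)"
    by (rule has_sum_SigmaI[where g = "\<lambda>m. ?f m * theta w r"])
       (use s in \<open>auto intro!: has_sum_cmult_right g has_sum_cmult_left f\<close>)
  then show ?thesis by simp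
qed

text \<open>
  The mechanism behind all splittings: if \<open>\<int>\<^sup>2\<close> is a disjoint union of finitely many translates of a sublattice
  with coordinates \<open>j\<close> and \<open>k\<close>, and the general term factors in \<open>j\<close> and \<open>k\<close> on each translate, then the
  product of two thetas is a finite sum of such products.
\<close>
lemma theta_mult_lattice:
  fixes A B :: "int \<Rightarrow> int \<Rightarrow> int \<Rightarrow> int" and S :: "int set"
  assumes r: "0 < r" "r < 1" "z \<noteq> 0" "w \<noteq> 0"
    and S: "finite S"
    and bij: "bij_betw (\<lambda>(s, j, k). (A s j k, B s j k)) (S \<times> UNIV) UNIV"
    and Z: "\<And>s. s \<in> S \<Longrightarrow> Z s \<noteq> 0" and W: "\<And>s. s \<in> S \<Longrightarrow> W s \<noteq> 0"
    and R: "0 < R" "R < 1"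
    and eq: "\<And>s j k. s \<in> S \<Longrightarrow> z powi A s j k * r powi (A s j k * A s j k) * (w powi B s j k * r powi (B s j k * B s j k))
      = c s * (Z s powi j * R powi (j * j) * (W s powi k * R powi (k * k)))"
  shows "theta z r * theta w r = (\<Sum>s\<in>S. c s * (theta (Z s) R * theta (W s) R))"
proof -
  let ?f = "\<lambda>(m, n). z powi m * r powi (m * m) * (w powi n * r powi (n * n))"
  let ?g = "\<lambda>(s, x). c s * (\<lambda>(j, k). Z s powi j * R powi (j * j) * (W s powi k * R powi (k * k))) x"
  have "((\<lambda>x. ?f ((\<lambda>(s, j, k). (A s j k, B s j k)) x)) has_sum (theta z r * theta w r)) (S \<times> UNIV)"
    using theta_mult[OF r] has_sum_reindex_bij_betw[OF bij, of ?f] by simp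
  then have "(?g has_sum (theta z r * theta w r)) (S \<times> UNIV)"
    by (rule has_sum_cong[THEN iffD1, rotated]) (auto simp: eq)
  then have "((\<lambda>s. c s * (theta (Z s) R * theta (W s) R)) has_sum (theta z r * theta w r)) S"
  proof (rule has_sum_Sigma')
    fix s assume "s \<in> S"
    then show "((\<lambda>y. ?g (s, y)) has_sum c s * (theta (Z s) R * theta (W s) R)) UNIV"
      using has_sum_cmult_right[OF theta_mult[OF R Z W], of s s "c s"] by simp
  qed
  then show ?thesis using has_sum_finite[OF S] has_sum_unique by blast
qed

text \<open>
  Here \<open>(m, n) = (j + k + s, j - k)\<close> with \<open>s \<in> {0, 1}\<close>, so that
  \<open>m\<^sup>2 + n\<^sup>2 = 2j\<^sup>2 + 2k\<^sup>2 + 2s(j + k) + s\<close>.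
\<close>
lemma theta_mult_parity:
  assumes r: "0 < r" "r < 1" "z \<noteq> 0" "w \<noteq> 0"
  shows "theta z r * theta w r = theta (z * w) (r\<^sup>2) * theta (z / w) (r\<^sup>2)
     + z * r * theta (z * w * r\<^sup>2) (r\<^sup>2) * theta (z / w * r\<^sup>2) (r\<^sup>2)"
proof -
  have "theta z r * theta w r = (\<Sum>s\<in>{0, 1}. (z * r) powi s * (theta (z * w * r powi (2 * s)) (r\<^sup>2) * theta (z / w * r powi (2 * s)) (r\<^sup>2)))"
  proof (rule theta_mult_lattice[where A = "\<lambda>s j k. j + k + s" and B = "\<lambda>s j k. j - k"])
    show "bij_betw (\<lambda>(s, j, k). (j + k + s, j - k)) ({0, 1} \<times> UNIV) (UNIV :: (int \<times> int) set)"
    proof (rule bij_betwI[of _ _ _ "\<lambda>(m, n). ((m + n) mod 2, (m + n) div 2, (m + n) div 2 - n)"], goal_cases)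
      case (3 x)
      obtain s j k where x: "x = (s, j, k)" by (cases x)
      have "j + k + s + (j - k) = s + 2 * j" by simp
      then show ?case using 3 by (auto simp: x)
    next
      case (4 y)
      show ?case by (auto split: prod.splits) presburger
    qed auto
    fix s j k :: int assume s: "s \<in> {0, 1}"
    have "r powi ((j + k + s) * (j + k + s)) * r powi ((j - k) * (j - k)) =
       r powi s * r powi (2 * s * j) * r powi (2 * s * k) * r powi (2 * (j * j)) * r powi (2 * (k * k))"
      using r s by (auto simp: power_int_add[symmetric] algebra_simps)
    note E = this
    have R: "(r powi (2 * s)) powi i = r powi (2 * s * i)" "(r\<^sup>2) powi i = r powi (2 * i)" for i
      by (simp_all add: power_int_mult)
    have "z powi (j + k + s) * r powi ((j + k + s) * (j + k + s)) * (w powi (j - k) * r powi ((j - k) * (j - k)))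
        = z powi (j + k + s) * w powi (j - k) * (r powi ((j + k + s) * (j + k + s)) * r powi ((j - k) * (j - k)))"
      by (simp only: mult_ac)
    also have "z powi (j + k + s) * w powi (j - k) = (z * w) powi j * (z / w) powi k * z powi s"
      using r by (simp add: power_int_add power_int_diff power_int_mult_distrib power_int_divide_distrib)
    finally show "z powi (j + k + s) * r powi ((j + k + s) * (j + k + s)) * (w powi (j - k) * r powi ((j - k) * (j - k))) =
       (z * r) powi s * ((z * w * r powi (2 * s)) powi j * (r\<^sup>2) powi (j * j) * ((z / w * r powi (2 * s)) powi k * (r\<^sup>2) powi (k * k)))"
      unfolding E power_int_mult_distrib[of "z * w"] power_int_mult_distrib[of "z / w"] power_int_mult_distrib[of z r] R
      by (simp only: mult_ac)
  qed (use r in \<open>auto simp: power_less_one_iff\<close>)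
  then show ?thesis by (simp add: power_int_mult mult.assoc)
qed

text \<open>
  Here \<open>(m, n) = (j - 2k, 2j + k + s)\<close>, where \<open>s\<close> is the residue of \<open>n - 2m\<close> modulo 5. The vectors \<open>(1, 2)\<close> and
  \<open>(-2, 1)\<close> are orthogonal of norm 5, so that \<open>m\<^sup>2 + n\<^sup>2 = 5j\<^sup>2 + 5k\<^sup>2 + 4sj + 2sk + s\<^sup>2\<close>.
\<close>
lemma theta_mult_quintic:
  assumes r: "0 < r" "r < 1" "z \<noteq> 0" "w \<noteq> 0"
  shows "theta z r * theta w r = (\<Sum>s\<in>{-2..2}. w powi s * r powi (s * s) *
     (theta (z * w\<^sup>2 * r powi (4 * s)) (r ^ 5) * theta (w / z\<^sup>2 * r powi (2 * s)) (r ^ 5)))"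
proof (rule theta_mult_lattice[where A = "\<lambda>s j k. j - 2 * k" and B = "\<lambda>s j k. 2 * j + k + s"])
  show "bij_betw (\<lambda>(s, j, k). (j - 2 * k, 2 * j + k + s)) ({-2..2} \<times> UNIV) (UNIV :: (int \<times> int) set)"
  proof (rule bij_betwI[of _ _ _ "\<lambda>(m, n). ((n - 2 * m + 2) mod 5 - 2, m + 2 * ((n - 2 * m + 2) div 5), (n - 2 * m + 2) div 5)"], goal_cases)
    case 2
    show ?case by (auto simp: algebra_simps; presburger)
  next
    case (3 x)
    obtain s j k where x: "x = (s, j, k)" by (cases x)
    have e: "2 * j + k + s - 2 * (j - 2 * k) + 2 = (s + 2) + k * 5" by simp
    have "((s + 2) + k * 5) div 5 = k" "((s + 2) + k * 5) mod 5 = s + 2" using 3 by (auto simp: x)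
    then show ?case unfolding x prod.case e by simp
  next
    case (4 y)
    show ?case by (auto split: prod.splits) presburger
  qed auto
  fix s j k :: int
  have "r powi ((j - 2 * k) * (j - 2 * k)) * r powi ((2 * j + k + s) * (2 * j + k + s)) =
       r powi (s * s) * r powi (4 * s * j) * r powi (2 * s * k) * r powi (5 * (j * j)) * r powi (5 * (k * k))"
    using r by (auto simp: power_int_add[symmetric] algebra_simps)
  note E = this
  have R: "(r powi (c * s)) powi i = r powi (c * s * i)" "(r ^ 5) powi i = r powi (5 * i)" for c i
    by (simp_all add: power_int_mult)
  have "z powi (j - 2 * k) * r powi ((j - 2 * k) * (j - 2 * k)) * (w powi (2 * j + k + s) * r powi ((2 * j + k + s) * (2 * j + k + s)))
     = z powi (j - 2 * k) * w powi (2 * j + k + s) * (r powi ((j - 2 * k) * (j - 2 * k)) * r powi ((2 * j + k + s) * (2 * j + k + s)))"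
    by (simp only: mult_ac)
  also have "z powi (j - 2 * k) * w powi (2 * j + k + s) = (z * w\<^sup>2) powi j * (w / z\<^sup>2) powi k * w powi s"
    using r by (simp add: power_int_add power_int_diff power_int_mult_distrib power_int_divide_distrib power_int_mult)
  finally show "z powi (j - 2 * k) * r powi ((j - 2 * k) * (j - 2 * k)) * (w powi (2 * j + k + s) * r powi ((2 * j + k + s) * (2 * j + k + s))) =
       w powi s * r powi (s * s) * ((z * w\<^sup>2 * r powi (4 * s)) powi j * (r ^ 5) powi (j * j) * ((w / z\<^sup>2 * r powi (2 * s)) powi k * (r ^ 5) powi (k * k)))"
    unfolding E power_int_mult_distrib[of "z * w\<^sup>2"] power_int_mult_distrib[of "w / z\<^sup>2"] R
    by (simp only: mult_ac)
qed (use r in \<open>auto simp: power_less_one_iff\<close>)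

section \<open>The three-term relation\<close>

text \<open>
  The modified theta function \<open>[z] = (z, p/z; p)\<^sub>\<infinity>\<close>: a theta series without the factor \<open>(p;p)\<^sub>\<infinity>\<close>.
\<close>
definition mtheta :: "real \<Rightarrow> real \<Rightarrow> real" where
  "mtheta z p = qpochhammer_inf z p * qpochhammer_inf (p / z) p"

lemma theta_eq_mtheta:
  assumes "0 < r" "r < 1" "z \<noteq> 0"
  shows "theta z r = mtheta (- z * r) (r\<^sup>2) * qpochhammer_inf (r\<^sup>2) (r\<^sup>2)"
proof -
  have "r\<^sup>2 / (- z * r) = - r / z" using assms by (simp add: power2_eq_square field_simps)
  then show ?thesis unfolding jacobi_triple_product[OF assms] mtheta_def by simp
qed

lemma mtheta_reflect: "p \<noteq> 0 \<Longrightarrow> mtheta (p / z) p = mtheta z p"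
  by (simp add: mtheta_def)

lemma mtheta_eq_theta:
  assumes "0 < r" "r < 1" "z \<noteq> 0"
  shows "mtheta z (r\<^sup>2) * qpochhammer_inf (r\<^sup>2) (r\<^sup>2) = theta (- z / r) r"
  using theta_eq_mtheta[of r "- z / r"] assms by simp

lemma mtheta_inverse:
  assumes "0 < p" "p < 1" "z \<noteq> 0"
  shows "mtheta (1 / z) p = - mtheta z p / z"
proof -
  define r where "r = sqrt p"
  have r: "0 < r" "r < 1" "p = r\<^sup>2" using assms by (auto simp: r_def)
  have K: "qpochhammer_inf p p \<noteq> 0" using assms by (intro qpoch_nonzero) auto
  have "mtheta (1 / z) p * qpochhammer_inf p p = theta (1 / (- z * r)) r"
    using mtheta_eq_theta[OF r(1,2), of "1 / z"] assms r by simp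
  also have "\<dots> = theta ((- z / r) * r\<^sup>2) r"
    unfolding theta_inverse using r by (simp add: power2_eq_square)
  also have "\<dots> = theta (- z / r) r / (- z)"
    using theta_shift[of "- z / r" r] assms r by simp
  also have "\<dots> = - mtheta z p / z * qpochhammer_inf p p"
    using mtheta_eq_theta[OF r(1,2), of z] assms r by (simp add: field_simps)
  finally show ?thesis by (rule mult_right_cancel[OF K, THEN iffD1])
qed

lemma mtheta_shift:
  assumes "0 < p" "p < 1" "z \<noteq> 0"
  shows "mtheta (p * z) p = - mtheta z p / z"
  using mtheta_inverse[OF assms] mtheta_reflect[of p "1 / z"] assms by simp

text \<open>
  By the parity splitting, \<open>[xy][x/y]\<close> is, up to \<open>x\<close> and a constant, the \<open>2 \<times> 2\<close> determinant of the
  vectors attached to \<open>x\<close> and to \<open>y\<close>. The quasi-period of theta makes the two vectors the same function of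
  their argument.
\<close>
lemma mtheta_product:
  assumes "0 < r" "r < 1" "x \<noteq> 0" "y \<noteq> 0"
  shows "mtheta (x * y) (r\<^sup>2) * mtheta (x / y) (r\<^sup>2) * (qpochhammer_inf (r\<^sup>2) (r\<^sup>2))\<^sup>2 =
    x * ((x * theta (x\<^sup>2 * r\<^sup>2) (r\<^sup>2)) * theta (y\<^sup>2) (r\<^sup>2) - theta (x\<^sup>2) (r\<^sup>2) * (y * theta (y\<^sup>2 * r\<^sup>2) (r\<^sup>2)))"
proof -
  let ?z = "- (x * y) / r" and ?w = "- (x / y) / r"
  have "mtheta (x * y) (r\<^sup>2) * mtheta (x / y) (r\<^sup>2) * (qpochhammer_inf (r\<^sup>2) (r\<^sup>2))\<^sup>2 = theta ?z r * theta ?w r"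
    using mtheta_eq_theta[of r "x * y"] mtheta_eq_theta[of r "x / y"] assms
    by (simp add: power2_eq_square mult_ac)
  also have "\<dots> = theta (?z * ?w) (r\<^sup>2) * theta (?z / ?w) (r\<^sup>2)
     + ?z * r * theta (?z * ?w * r\<^sup>2) (r\<^sup>2) * theta (?z / ?w * r\<^sup>2) (r\<^sup>2)"
    using assms by (intro theta_mult_parity) auto
  also have "?z * ?w = x\<^sup>2 / r\<^sup>2" using assms by (simp add: power2_eq_square)
  also have "?z / ?w = y\<^sup>2" using assms by (simp add: power2_eq_square field_simps)
  also have "?z * r = - (x * y)" using assms by simp
  also have "theta (x\<^sup>2 / r\<^sup>2) (r\<^sup>2) = x\<^sup>2 * theta (x\<^sup>2 * r\<^sup>2) (r\<^sup>2)"
  proof -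
    have "x\<^sup>2 / r\<^sup>2 * (r\<^sup>2)\<^sup>2 = x\<^sup>2 * r\<^sup>2" using assms by (simp add: power2_eq_square)
    then show ?thesis using theta_shift[of "x\<^sup>2 / r\<^sup>2" "r\<^sup>2"] assms by simp
  qed
  also have "x\<^sup>2 / r\<^sup>2 * r\<^sup>2 = x\<^sup>2" using assms by simp
  finally show ?thesis by (simp add: algebra_simps power2_eq_square)
qed

text \<open>
  Weierstrass' relation. With \<open>[xy][x/y]\<close> written as a determinant \<open>x \<cdot> det(x, y)\<close>, it becomes the Pluecker relation
  \<open>det(x, y) det(u, v) - det(x, v) det(u, y) = det(x, u) det(y, v)\<close> between four vectors in the plane.
\<close>
theorem mtheta_three_term:
  assumes "0 < p" "p < 1" "x \<noteq> 0" "y \<noteq> 0" "u \<noteq> 0" "v \<noteq> 0"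
  shows "mtheta (x * y) p * mtheta (x / y) p * (mtheta (u * v) p * mtheta (u / v) p)
       - mtheta (x * v) p * mtheta (x / v) p * (mtheta (u * y) p * mtheta (u / y) p)
       = u / y * (mtheta (y * v) p * mtheta (y / v) p * (mtheta (x * u) p * mtheta (x / u) p))"
proof -
  define r where "r = sqrt p"
  have r: "0 < r" "r < 1" "p = r\<^sup>2" using assms by (auto simp: r_def)
  define K where "K = (qpochhammer_inf p p)\<^sup>2"
  define e where "e x = x * theta (x\<^sup>2 * r\<^sup>2) (r\<^sup>2)" for x
  define d where "d x = theta (x\<^sup>2) (r\<^sup>2)" for x
  define M where "M x y = mtheta (x * y) p * mtheta (x / y) p" for x y
  have K: "K \<noteq> 0" using assms unfolding K_def by (simp add: qpoch_nonzero)
  have M: "M x y * K = x * (e x * d y - d x * e y)" if "x \<noteq> 0" "y \<noteq> 0" for x y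
    using mtheta_product[OF r(1,2) that] unfolding M_def K_def e_def d_def r(3) .
  have "K * K * (M x y * M u v - M x v * M u y) = (M x y * K) * (M u v * K) - (M x v * K) * (M u y * K)"
    by (simp only: right_diff_distrib mult_ac)
  also have "\<dots> = u / y * ((M y v * K) * (M x u * K))"
    using assms by (simp only: M not_False_eq_True) (simp add: field_simps)
  also have "\<dots> = K * K * (u / y * (M y v * M x u))" by (simp only: mult_ac)
  finally show ?thesis
    unfolding M_def by (rule mult_left_cancel[OF no_zero_divisors[OF K K], THEN iffD1])
qed

abbreviation m10 :: "real \<Rightarrow> real \<Rightarrow> real" where
  "m10 q z \<equiv> mtheta z (q ^ 10)"

context
  fixes q :: real
  assumes q: "0 < q" "q < 1"
begin

lemma tenth_power_bounds: "0 < q ^ 10" "q ^ 10 < 1" "norm (q ^ 10) < 1"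
  using q by (auto simp: power_less_one_iff)

lemma m10_reflect: "m10 q (q ^ 10 / z) = m10 q z"
  using q by (intro mtheta_reflect) auto

text \<open>
  The values of \<open>x, y, u, v\<close> in this proof and in the next two are chosen such that the eight arguments on the left become,
  up to \<open>z \<mapsto> 1/z\<close> and \<open>z \<mapsto> q\<^sup>1\<^sup>0/z\<close>, those of the two terms that have to be combined.
\<close>
lemma three_term_third_square:
  "m10 q (- q) * m10 q (- (q ^ 3)) ^ 2 * m10 q (- (q ^ 5)) - q * m10 q (- 1) * m10 q (- (q ^ 2)) ^ 2 * m10 q (- (q ^ 4))
   = m10 q q * m10 q (q ^ 3) ^ 2 * m10 q (q ^ 5)"
proof -
  note t = mtheta_three_term[OF tenth_power_bounds(1,2), of q "- q\<^sup>2" "q ^ 4" "- q"]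
  have e: "q * (- q\<^sup>2) = - (q ^ 3)" "q / (- q\<^sup>2) = 1 / (- q)" "q ^ 4 * - q = - (q ^ 5)" "q ^ 4 / - q = - (q ^ 3)"
    "q * - q = - q\<^sup>2" "q / - q = - 1" "q ^ 4 * - q\<^sup>2 = - (q ^ 6)" "q ^ 4 / - q\<^sup>2 = - q\<^sup>2"
    "- q\<^sup>2 * - q = q ^ 3" "- q\<^sup>2 / - q = q" "q * q ^ 4 = q ^ 5" "q / q ^ 4 = 1 / q ^ 3"
    using q by (simp_all add: field_simps power_numeral_reduce)
  have s: "m10 q (1 / - q) = m10 q (- q) / q" "m10 q (1 / q ^ 3) = - m10 q (q ^ 3) / q ^ 3" "m10 q (- (q ^ 6)) = m10 q (- (q ^ 4))"
    using mtheta_inverse[OF tenth_power_bounds(1,2), of "- q"] mtheta_inverse[OF tenth_power_bounds(1,2), of "q ^ 3"]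
      m10_reflect[of "- (q ^ 4)"] q power_diff[of q 4 10] by simp_all
  have alg: "A * C\<^sup>2 * E - q * N * B\<^sup>2 * D = A' * C'\<^sup>2 * E'"
    if "C * (A / q) * (E * C) - B * N * (D * B) = - q\<^sup>2 * (C' * A' * (E' * (- C' / q ^ 3)))"
    for A B C D E N A' C' E' :: real
    using that q by (simp add: field_simps power_numeral_reduce)
  show ?thesis by (rule alg) (use t q in \<open>simp only: e s, simp\<close>)
qed

lemma three_term_first_square:
  "m10 q (- 1) * m10 q (- (q ^ 2)) * m10 q (- (q ^ 4)) ^ 2 - m10 q (- q) ^ 2 * m10 q (- (q ^ 3)) * m10 q (- (q ^ 5))
   = m10 q q ^ 2 * m10 q (q ^ 3) * m10 q (q ^ 5)"
proof -
  note t = mtheta_three_term[OF tenth_power_bounds(1,2), of "q\<^sup>2" "- q\<^sup>2" "q ^ 3" "- q"]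
  have e: "q\<^sup>2 * - q\<^sup>2 = - (q ^ 4)" "q\<^sup>2 / (- q\<^sup>2) = - 1" "q ^ 3 * - q = - (q ^ 4)" "q ^ 3 / - q = - q\<^sup>2"
    "q\<^sup>2 * - q = - (q ^ 3)" "q\<^sup>2 / - q = - q" "q ^ 3 * - q\<^sup>2 = - (q ^ 5)" "q ^ 3 / - q\<^sup>2 = - q"
    "- q\<^sup>2 * - q = q ^ 3" "- q\<^sup>2 / - q = q" "q\<^sup>2 * q ^ 3 = q ^ 5" "q\<^sup>2 / q ^ 3 = 1 / q"
    using q by (simp_all add: field_simps power_numeral_reduce)
  have s: "m10 q (1 / q) = - m10 q q / q"
    using mtheta_inverse[OF tenth_power_bounds(1,2)] q by auto
  have alg: "N * B * D\<^sup>2 - A\<^sup>2 * C * E = A'\<^sup>2 * C' * E'"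
    if "D * N * (D * B) - C * A * (E * A) = - q * (C' * A' * (E' * (- A' / q)))"
    for A B C D E N A' C' E' :: real
    using that q by (simp add: field_simps power_numeral_reduce)
  show ?thesis by (rule alg) (use t q in \<open>simp only: e s, simp\<close>)
qed

lemma three_term_no_unit:
  "m10 q (- (q ^ 2)) ^ 2 * m10 q (- (q ^ 4)) ^ 2 - q * m10 q (- q) ^ 2 * m10 q (- (q ^ 3)) ^ 2
   = m10 q q * m10 q (q ^ 3) * m10 q (q ^ 5) ^ 2"
proof -
  note t = mtheta_three_term[OF tenth_power_bounds(1,2), of "q ^ 5" "- (q ^ 3)" 1 "- (q ^ 4)"]
  have e: "q ^ 5 * - (q ^ 3) = - (q ^ 8)" "q ^ 5 / (- (q ^ 3)) = - q\<^sup>2" 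
    "q ^ 5 * - (q ^ 4) = - (q ^ 9)" "q ^ 5 / - (q ^ 4) = - q"
    "- (q ^ 3) * - (q ^ 4) = q ^ 7" "- (q ^ 3) / - (q ^ 4) = 1 / q"
    using q by (simp_all add: field_simps power_numeral_reduce)
  have s: "m10 q (1 / q) = - m10 q q / q" "m10 q (1 / - (q ^ 3)) = m10 q (- (q ^ 3)) / q ^ 3" "m10 q (1 / - (q ^ 4)) = m10 q (- (q ^ 4)) / q ^ 4"
    using mtheta_inverse[OF tenth_power_bounds(1,2), of q] mtheta_inverse[OF tenth_power_bounds(1,2), of "- (q ^ 3)"]
      mtheta_inverse[OF tenth_power_bounds(1,2), of "- (q ^ 4)"] q by simp_all
  have s': "m10 q (- (q ^ 8)) = m10 q (- q\<^sup>2)" "m10 q (- (q ^ 9)) = m10 q (- q)" "m10 q (q ^ 7) = m10 q (q ^ 3)"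
    using m10_reflect[of "- q\<^sup>2"] m10_reflect[of "- q"] m10_reflect[of "q ^ 3"]
      power_diff[of q 2 10] power_diff[of q 1 10] power_diff[of q 3 10] q by simp_all
  have alg: "B\<^sup>2 * D\<^sup>2 - q * A\<^sup>2 * C\<^sup>2 = A' * C' * E'\<^sup>2"
    if "B * B * (D * (D / q ^ 4)) - A * A * (C * (C / q ^ 3)) = 1 / - (q ^ 3) * (C' * (- A' / q) * (E' * E'))"
    for A B C D A' C' E' :: real
    using that q by (simp add: field_simps power_numeral_reduce)
  show ?thesis by (rule alg) (use t q in \<open>simp only: e s s' mult_1 mult_1_right div_by_1, simp\<close>)
qed

end

section \<open>The 5-dissection\<close>

text \<open>
  Ramanujan's \<open>\<phi>(q)\<close>, with the five progressions modulo 10 of odd exponents collected into brackets.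
\<close>
lemma theta_one_eq:
  assumes q: "0 < q" "q < 1"
  shows "theta 1 q = m10 q (- q) ^ 2 * m10 q (- (q ^ 3)) ^ 2 * m10 q (- (q ^ 5)) * qpochhammer_inf (q\<^sup>2) (q\<^sup>2)"
proof -
  have n: "norm (q\<^sup>2) < 1" using q by (simp add: power_less_one_iff)
  have "qpochhammer_inf (- q) (q\<^sup>2) = (\<Prod>i<5. qpochhammer_inf (- (q * q ^ (2 * i))) (q ^ 10))"
    by (subst qpoch_multisection[OF n, of 5]) (simp_all flip: power_mult)
  also have "\<dots> = qpochhammer_inf (- q) (q ^ 10) * qpochhammer_inf (- (q ^ 3)) (q ^ 10) * qpochhammer_inf (- (q ^ 5)) (q ^ 10)
      * qpochhammer_inf (- (q ^ 7)) (q ^ 10) * qpochhammer_inf (- (q ^ 9)) (q ^ 10)"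
    by (simp add: lessThan_nat_numeral lessThan_Suc flip: power_Suc)
  finally have P: "qpochhammer_inf (- q) (q\<^sup>2) = \<dots>" .
  have e: "q ^ 10 / - q = - (q ^ 9)" "q ^ 10 / - (q ^ 3) = - (q ^ 7)" "q ^ 10 / - (q ^ 5) = - (q ^ 5)"
    using q power_diff[of q 1 10] power_diff[of q 3 10] power_diff[of q 5 10] by simp_all
  show ?thesis
    using jacobi_triple_product[OF q, of 1] unfolding mtheta_def e
    by (simp add: P power_mult_distrib power2_eq_square[of "qpochhammer_inf a b" for a b] mult_ac)
qed

text \<open>
  This is \<open>2 \<psi>(q\<^sup>2)\<close> in Ramanujan's notation; the factor 2 is hidden in \<open>[-1]\<close>.
\<close>
lemma theta_self_eq:
  assumes q: "0 < q" "q < 1"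
  shows "theta q q = m10 q (- 1) * m10 q (- (q ^ 2)) ^ 2 * m10 q (- (q ^ 4)) ^ 2 * qpochhammer_inf (q\<^sup>2) (q\<^sup>2)"
proof -
  have n: "norm (q\<^sup>2) < 1" using q by (simp add: power_less_one_iff)
  have "qpochhammer_inf (- (q\<^sup>2)) (q\<^sup>2) = (\<Prod>i<5. qpochhammer_inf (- (q\<^sup>2 * q ^ (2 * i))) (q ^ 10))"
    by (subst qpoch_multisection[OF n, of 5]) (simp_all flip: power_mult)
  also have "\<dots> = qpochhammer_inf (- (q ^ 2)) (q ^ 10) * qpochhammer_inf (- (q ^ 4)) (q ^ 10) * qpochhammer_inf (- (q ^ 6)) (q ^ 10)
      * qpochhammer_inf (- (q ^ 8)) (q ^ 10) * qpochhammer_inf (- (q ^ 10)) (q ^ 10)"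
    by (simp add: lessThan_nat_numeral lessThan_Suc flip: power_add power_Suc numeral_2_eq_2)
  finally have P: "qpochhammer_inf (- (q\<^sup>2)) (q\<^sup>2) = \<dots>" .
  have "qpochhammer_inf (- 1) (q\<^sup>2) = (\<Prod>i<5. qpochhammer_inf (- (q ^ (2 * i))) (q ^ 10))"
    by (subst qpoch_multisection[OF n, of 5]) (simp_all flip: power_mult)
  also have "\<dots> = qpochhammer_inf (- 1) (q ^ 10) * qpochhammer_inf (- (q ^ 2)) (q ^ 10) * qpochhammer_inf (- (q ^ 4)) (q ^ 10)
      * qpochhammer_inf (- (q ^ 6)) (q ^ 10) * qpochhammer_inf (- (q ^ 8)) (q ^ 10)"
    by (simp add: lessThan_nat_numeral lessThan_Suc)
  finally have P1: "qpochhammer_inf (- 1) (q\<^sup>2) = \<dots>" .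
  have e: "q ^ 10 / - 1 = - (q ^ 10)" "q ^ 10 / - (q ^ 2) = - (q ^ 8)" "q ^ 10 / - (q ^ 4) = - (q ^ 6)"
    using q power_diff[of q 2 10] power_diff[of q 4 10] by simp_all
  have "theta q q = qpochhammer_inf (- (q\<^sup>2)) (q\<^sup>2) * qpochhammer_inf (- 1) (q\<^sup>2) * qpochhammer_inf (q\<^sup>2) (q\<^sup>2)"
    using jacobi_triple_product[OF q, of q] q by (simp add: power2_eq_square)
  then show ?thesis unfolding mtheta_def e P P1
    by (simp add: power_mult_distrib power2_eq_square[of "qpochhammer_inf a b" for a b] mult_ac)
qed

text \<open>
  Euler: there are as many partitions into distinct parts as into odd parts.
\<close>
lemma euler_odd_distinct:
  fixes q :: real
  assumes q: "0 < q" "q < 1"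
  shows "qpochhammer_inf (- q) q * qpochhammer_inf q (q\<^sup>2) = 1"
proof -
  have n: "norm q < 1" "norm (q\<^sup>2) < 1" using q by (auto simp: power_less_one_iff)
  have nz: "qpochhammer_inf (q\<^sup>2) (q\<^sup>2) \<noteq> 0" by (rule qpoch_nonzero) (use n in auto)
  have "qpochhammer_inf q q = qpochhammer_inf q (q\<^sup>2) * qpochhammer_inf (q\<^sup>2) (q\<^sup>2)"
    using qpoch_multisection[OF n(1), of 2 q] by (simp add: lessThan_nat_numeral lessThan_Suc power2_eq_square)
  with qpoch_mult_uminus[OF n(1), of q] nz show ?thesis by (simp add: mult.commute)
qed

lemma qpoch_self_eq_mtheta:
  fixes q :: real
  assumes q: "0 < q" "q < 1"
  shows "qpochhammer_inf q q ^ 2 = (m10 q q * m10 q (q ^ 2) * m10 q (q ^ 3) * m10 q (q ^ 4)) ^ 2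
     * m10 q (q ^ 5) * qpochhammer_inf (q ^ 10) (q ^ 10) ^ 2"
proof -
  have n: "norm q < 1" using q by auto
  have "qpochhammer_inf q q = (\<Prod>i<10. qpochhammer_inf (q * q ^ i) (q ^ 10))"
    by (subst qpoch_multisection[OF n, of 10]) simp_all
  also have "\<dots> = qpochhammer_inf q (q ^ 10) * qpochhammer_inf (q ^ 2) (q ^ 10) * qpochhammer_inf (q ^ 3) (q ^ 10) * qpochhammer_inf (q ^ 4) (q ^ 10)
     * qpochhammer_inf (q ^ 5) (q ^ 10) * qpochhammer_inf (q ^ 6) (q ^ 10) * qpochhammer_inf (q ^ 7) (q ^ 10) * qpochhammer_inf (q ^ 8) (q ^ 10)
     * qpochhammer_inf (q ^ 9) (q ^ 10) * qpochhammer_inf (q ^ 10) (q ^ 10)"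
    by (simp add: lessThan_nat_numeral lessThan_Suc flip: power_Suc numeral_2_eq_2)
  finally have P: "qpochhammer_inf q q = \<dots>" .
  have e: "q ^ 10 / q = q ^ 9" "q ^ 10 / q ^ 2 = q ^ 8" "q ^ 10 / q ^ 3 = q ^ 7" "q ^ 10 / q ^ 4 = q ^ 6" "q ^ 10 / q ^ 5 = q ^ 5"
    using q power_diff[of q 1 10] power_diff[of q 2 10] power_diff[of q 3 10] power_diff[of q 4 10] power_diff[of q 5 10] by simp_all
  show ?thesis unfolding P mtheta_def e
    by (simp add: power_mult_distrib power2_eq_square[of "qpochhammer_inf a b" for a b] mult_ac)
qed

lemma theta_pow_eq_mtheta:
  assumes q: "0 < q" "q < 1"
  shows "theta (q ^ a) (q ^ 5) = mtheta (- (q ^ (a + 5))) (q ^ 10) * qpochhammer_inf (q ^ 10) (q ^ 10)"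
    "theta (- (q ^ a)) (q ^ 5) = m10 q (q ^ (a + 5)) * qpochhammer_inf (q ^ 10) (q ^ 10)"
proof -
  have r: "0 < q ^ 5" "q ^ 5 < 1" "(q ^ 5)\<^sup>2 = q ^ 10" using q by (auto simp: power_less_one_iff simp flip: power_mult)
  show "theta (q ^ a) (q ^ 5) = mtheta (- (q ^ (a + 5))) (q ^ 10) * qpochhammer_inf (q ^ 10) (q ^ 10)"
    "theta (- (q ^ a)) (q ^ 5) = m10 q (q ^ (a + 5)) * qpochhammer_inf (q ^ 10) (q ^ 10)"
    using theta_eq_mtheta[OF r(1,2), of "q ^ a"] theta_eq_mtheta[OF r(1,2), of "- (q ^ a)"] q
    by (simp_all add: r(3) power_add)
qed

text \<open>
  The thetas that come out of the quintic splitting, after reflecting and shifting the argument of the bracket to an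
  exponent between 0 and 5. The last one vanishes; it accounts for the empty residue class 3 modulo 5.
\<close>
lemma theta_fifth_power_values:
  assumes q: "0 < q" "q < 1"
  defines "K \<equiv> qpochhammer_inf (q ^ 10) (q ^ 10)"
  shows "theta 1 (q ^ 5) = m10 q (- (q ^ 5)) * K"
    "theta q (q ^ 5) = m10 q (- (q ^ 4)) * K" 
    "theta (q ^ 3) (q ^ 5) = m10 q (- (q ^ 2)) * K" 
    "theta (q ^ 4) (q ^ 5) = m10 q (- q) * K" 
    "theta (q ^ 5) (q ^ 5) = m10 q (- 1) * K" 
    "theta (q ^ 8) (q ^ 5) = m10 q (- (q ^ 3)) / q ^ 3 * K" 
    "theta (q ^ 9) (q ^ 5) = m10 q (- (q ^ 4)) / q ^ 4 * K" 
    "theta (- q) (q ^ 5) = m10 q (q ^ 4) * K" 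
    "theta (- (q ^ 3)) (q ^ 5) = m10 q (q ^ 2) * K" 
    "theta (- (q ^ 5)) (q ^ 5) = 0" 
proof -
  note t = theta_pow_eq_mtheta[OF q]
  have p: "0 < q ^ 10" "q ^ 10 < 1" using q by (auto simp: power_less_one_iff)
  note r = mtheta_reflect[of "q ^ 10"] and s = mtheta_shift[OF p]
  have d: "q ^ 10 / q ^ 4 = q ^ 6" "q ^ 10 / q ^ 2 = q ^ 8" "q ^ 10 / q = q ^ 9" "q ^ 10 * q ^ 3 = q ^ 13" "q ^ 10 * q ^ 4 = q ^ 14"
    using q power_diff[of q 4 10] power_diff[of q 2 10] power_diff[of q 1 10] by (simp_all flip: power_add)
  show "theta 1 (q ^ 5) = m10 q (- (q ^ 5)) * K" using t(1)[of 0] by (simp add: K_def)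
  show "theta q (q ^ 5) = m10 q (- (q ^ 4)) * K" using t(1)[of 1] r[of "- (q ^ 4)"] q d by (simp add: K_def)
  show "theta (q ^ 3) (q ^ 5) = m10 q (- (q ^ 2)) * K" using t(1)[of 3] r[of "- (q ^ 2)"] q d by (simp add: K_def)
  show "theta (q ^ 4) (q ^ 5) = m10 q (- q) * K" using t(1)[of 4] r[of "- q"] q d by (simp add: K_def)
  show "theta (q ^ 5) (q ^ 5) = m10 q (- 1) * K" using t(1)[of 5] r[of "- 1"] q d by (simp add: K_def)
  show "theta (q ^ 8) (q ^ 5) = m10 q (- (q ^ 3)) / q ^ 3 * K" using t(1)[of 8] s[of "- (q ^ 3)"] q d by (simp add: K_def)
  show "theta (q ^ 9) (q ^ 5) = m10 q (- (q ^ 4)) / q ^ 4 * K" using t(1)[of 9] s[of "- (q ^ 4)"] q d by (simp add: K_def)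
  show "theta (- q) (q ^ 5) = m10 q (q ^ 4) * K" using t(2)[of 1] r[of "q ^ 4"] q d by (simp add: K_def)
  show "theta (- (q ^ 3)) (q ^ 5) = m10 q (q ^ 2) * K" using t(2)[of 3] r[of "q ^ 2"] q d by (simp add: K_def)
  show "theta (- (q ^ 5)) (q ^ 5) = 0" using q by (intro theta_eq_0) auto
qed

lemma interval_minus2_2: "{-2..2::int} = {-2, -1, 0, 1, 2}" by auto

text \<open>
  The quintic splitting with \<open>z = q\<^sup>3\<close> and \<open>w = -q\<close>. Then \<open>z w\<^sup>2 = Q\<close> and \<open>w/z\<^sup>2 = -1/Q\<close>, so that \<open>q\<close> itself
  survives only in the coefficients \<open>w\<^sup>s = (-q)\<^sup>s\<close>.
\<close>
lemma theta_pair_dissection_1: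
  fixes q :: real
  assumes q: "0 < q" "q < 1"
  defines "Q \<equiv> q ^ 5"
  defines "K \<equiv> qpochhammer_inf (Q ^ 10) (Q ^ 10)"
  shows "theta (q ^ 3) Q * theta (- q) Q = K\<^sup>2 * (m10 Q (- (Q ^ 4)) * m10 Q (Q ^ 4) - q * Q * m10 Q (- 1) * m10 Q (Q ^ 4)
     - Q / q * m10 Q (- (Q ^ 2)) * m10 Q (Q ^ 2) + q\<^sup>2 * m10 Q (- (Q ^ 4)) * m10 Q (Q ^ 2))"
proof -
  have Q: "0 < Q" "Q < 1" using q by (auto simp: Q_def power_less_one_iff)
  note v = theta_fifth_power_values[OF Q, folded K_def]
  have zw: "q ^ 3 * (- q)\<^sup>2 = Q" "- q / (q ^ 3)\<^sup>2 = 1 / - Q"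
    using q by (simp_all add: Q_def power_numeral_reduce field_simps)
  have e: "theta (Q / Q ^ 8) (Q ^ 5) * theta (1 / - Q / Q ^ 4) (Q ^ 5) = 0"
    "theta (Q / Q ^ 4) (Q ^ 5) * theta (1 / - Q / Q ^ 2) (Q ^ 5) = m10 Q (- (Q ^ 2)) * m10 Q (Q ^ 2) * K\<^sup>2"
    "theta Q (Q ^ 5) * theta (1 / - Q) (Q ^ 5) = m10 Q (- (Q ^ 4)) * m10 Q (Q ^ 4) * K\<^sup>2"
    "theta (Q * Q ^ 4) (Q ^ 5) * theta (1 / - Q * Q ^ 2) (Q ^ 5) = m10 Q (- 1) * m10 Q (Q ^ 4) * K\<^sup>2"
    "theta (Q * Q ^ 8) (Q ^ 5) * theta (1 / - Q * Q ^ 4) (Q ^ 5) = m10 Q (- (Q ^ 4)) * m10 Q (Q ^ 2) / Q ^ 4 * K\<^sup>2"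
  proof -
    have "1 / - Q / Q ^ 4 = 1 / - (Q ^ 5)" "1 / - Q / Q ^ 2 = 1 / - (Q ^ 3)"
      "1 / - Q * Q ^ 2 = - Q" "1 / - Q * Q ^ 4 = - (Q ^ 3)" "Q / Q ^ 4 = 1 / Q ^ 3" "Q * Q ^ 4 = Q ^ 5" "Q * Q ^ 8 = Q ^ 9"
      using Q by (simp_all add: field_simps power_numeral_reduce)
    then show "theta (Q / Q ^ 8) (Q ^ 5) * theta (1 / - Q / Q ^ 4) (Q ^ 5) = 0"
      "theta (Q / Q ^ 4) (Q ^ 5) * theta (1 / - Q / Q ^ 2) (Q ^ 5) = m10 Q (- (Q ^ 2)) * m10 Q (Q ^ 2) * K\<^sup>2"
      "theta Q (Q ^ 5) * theta (1 / - Q) (Q ^ 5) = m10 Q (- (Q ^ 4)) * m10 Q (Q ^ 4) * K\<^sup>2"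
      "theta (Q * Q ^ 4) (Q ^ 5) * theta (1 / - Q * Q ^ 2) (Q ^ 5) = m10 Q (- 1) * m10 Q (Q ^ 4) * K\<^sup>2"
      "theta (Q * Q ^ 8) (Q ^ 5) * theta (1 / - Q * Q ^ 4) (Q ^ 5) = m10 Q (- (Q ^ 4)) * m10 Q (Q ^ 2) / Q ^ 4 * K\<^sup>2"
      by (simp_all only: theta_inverse v) (simp_all add: power2_eq_square)
  qed
  have "theta (q ^ 3) Q * theta (- q) Q = (\<Sum>s\<in>{-2..2}. (- q) powi s * Q powi (s * s) *
     (theta (Q * Q powi (4 * s)) (Q ^ 5) * theta ((1 / - Q) * Q powi (2 * s)) (Q ^ 5)))"
    using theta_mult_quintic[OF Q, of "q ^ 3" "- q"] q unfolding zw by simp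
  also have "\<dots> = Q ^ 4 / q ^ 2 * (theta (Q / Q ^ 8) (Q ^ 5) * theta (1 / - Q / Q ^ 4) (Q ^ 5))
     - Q / q * (theta (Q / Q ^ 4) (Q ^ 5) * theta (1 / - Q / Q ^ 2) (Q ^ 5))
     + theta Q (Q ^ 5) * theta (1 / - Q) (Q ^ 5)
     - q * Q * (theta (Q * Q ^ 4) (Q ^ 5) * theta (1 / - Q * Q ^ 2) (Q ^ 5))
     + q\<^sup>2 * Q ^ 4 * (theta (Q * Q ^ 8) (Q ^ 5) * theta (1 / - Q * Q ^ 4) (Q ^ 5))"
    unfolding interval_minus2_2 by (simp add: power_int_minus divide_inverse)
  also have "\<dots> = K\<^sup>2 * (m10 Q (- (Q ^ 4)) * m10 Q (Q ^ 4) - q * Q * m10 Q (- 1) * m10 Q (Q ^ 4)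
     - Q / q * m10 Q (- (Q ^ 2)) * m10 Q (Q ^ 2) + q\<^sup>2 * m10 Q (- (Q ^ 4)) * m10 Q (Q ^ 2))"
    unfolding e using q Q by (simp add: field_simps)
  finally show ?thesis .
qed

text \<open>
  The quintic splitting with \<open>z = q\<^sup>-\<^sup>2\<close>, which is as good as \<open>q\<^sup>2\<close>, and \<open>w = -q\<close>. Then \<open>z w\<^sup>2 = 1\<close> and
  \<open>w/z\<^sup>2 = -Q\<close>.
\<close>
lemma theta_pair_dissection_2:
  fixes q :: real
  assumes q: "0 < q" "q < 1"
  defines "Q \<equiv> q ^ 5"
  defines "K \<equiv> qpochhammer_inf (Q ^ 10) (Q ^ 10)"
  shows "theta (q\<^sup>2) Q * theta (- q) Q = K\<^sup>2 * (m10 Q (- (Q ^ 5)) * m10 Q (Q ^ 4) - q * Q * m10 Q (- Q) * m10 Q (Q ^ 2)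
     - Q / q * m10 Q (- Q) * m10 Q (Q ^ 4) + Q / q\<^sup>2 * m10 Q (- (Q ^ 3)) * m10 Q (Q ^ 2))"
proof -
  have Q: "0 < Q" "Q < 1" using q by (auto simp: Q_def power_less_one_iff)
  note v = theta_fifth_power_values[OF Q, folded K_def]
  have zw: "1 / q\<^sup>2 * (- q)\<^sup>2 = 1" "- q / (1 / q\<^sup>2)\<^sup>2 = - Q"
    using q by (simp_all add: Q_def power_numeral_reduce field_simps)
  have e: "theta (1 / Q ^ 8) (Q ^ 5) * theta (- Q / Q ^ 4) (Q ^ 5) = m10 Q (- (Q ^ 3)) * m10 Q (Q ^ 2) / Q ^ 3 * K\<^sup>2"
    "theta (1 / Q ^ 4) (Q ^ 5) * theta (- Q / Q ^ 2) (Q ^ 5) = m10 Q (- Q) * m10 Q (Q ^ 4) * K\<^sup>2"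
    "theta 1 (Q ^ 5) * theta (- Q) (Q ^ 5) = m10 Q (- (Q ^ 5)) * m10 Q (Q ^ 4) * K\<^sup>2"
    "theta (Q ^ 4) (Q ^ 5) * theta (- Q * Q ^ 2) (Q ^ 5) = m10 Q (- Q) * m10 Q (Q ^ 2) * K\<^sup>2"
    "theta (Q ^ 8) (Q ^ 5) * theta (- Q * Q ^ 4) (Q ^ 5) = 0"
  proof -
    have "- Q / Q ^ 4 = 1 / - (Q ^ 3)" "- Q / Q ^ 2 = 1 / - Q" "- Q * Q ^ 2 = - (Q ^ 3)" "- Q * Q ^ 4 = - (Q ^ 5)"
      using Q by (simp_all add: field_simps power_numeral_reduce)
    then show "theta (1 / Q ^ 8) (Q ^ 5) * theta (- Q / Q ^ 4) (Q ^ 5) = m10 Q (- (Q ^ 3)) * m10 Q (Q ^ 2) / Q ^ 3 * K\<^sup>2"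
      "theta (1 / Q ^ 4) (Q ^ 5) * theta (- Q / Q ^ 2) (Q ^ 5) = m10 Q (- Q) * m10 Q (Q ^ 4) * K\<^sup>2"
      "theta 1 (Q ^ 5) * theta (- Q) (Q ^ 5) = m10 Q (- (Q ^ 5)) * m10 Q (Q ^ 4) * K\<^sup>2"
      "theta (Q ^ 4) (Q ^ 5) * theta (- Q * Q ^ 2) (Q ^ 5) = m10 Q (- Q) * m10 Q (Q ^ 2) * K\<^sup>2"
      "theta (Q ^ 8) (Q ^ 5) * theta (- Q * Q ^ 4) (Q ^ 5) = 0"
      by (simp_all only: theta_inverse v) (simp_all add: power2_eq_square)
  qed
  have "theta (q\<^sup>2) Q * theta (- q) Q = theta (1 / q\<^sup>2) Q * theta (- q) Q" by (simp only: theta_inverse)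
  also have "\<dots> = (\<Sum>s\<in>{-2..2}. (- q) powi s * Q powi (s * s) *
     (theta (1 * Q powi (4 * s)) (Q ^ 5) * theta (- Q * Q powi (2 * s)) (Q ^ 5)))"
    using theta_mult_quintic[OF Q, of "1 / q\<^sup>2" "- q"] q unfolding zw by simp
  also have "\<dots> = Q ^ 4 / q ^ 2 * (theta (1 / Q ^ 8) (Q ^ 5) * theta (- Q / Q ^ 4) (Q ^ 5))
     - Q / q * (theta (1 / Q ^ 4) (Q ^ 5) * theta (- Q / Q ^ 2) (Q ^ 5))
     + theta 1 (Q ^ 5) * theta (- Q) (Q ^ 5)
     - q * Q * (theta (Q ^ 4) (Q ^ 5) * theta (- Q * Q ^ 2) (Q ^ 5))
     + q\<^sup>2 * Q ^ 4 * (theta (Q ^ 8) (Q ^ 5) * theta (- Q * Q ^ 4) (Q ^ 5))"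
    unfolding interval_minus2_2 by (simp add: power_int_minus divide_inverse)
  also have "\<dots> = K\<^sup>2 * (m10 Q (- (Q ^ 5)) * m10 Q (Q ^ 4) - q * Q * m10 Q (- Q) * m10 Q (Q ^ 2)
     - Q / q * m10 Q (- Q) * m10 Q (Q ^ 4) + Q / q\<^sup>2 * m10 Q (- (Q ^ 3)) * m10 Q (Q ^ 2))"
    unfolding e using q Q by (simp add: field_simps power_numeral_reduce)
  finally show ?thesis .
qed

lemma m10_nonzero:
  assumes "0 < q" "q < 1" "0 < a" "a < 10"
  shows "m10 q (q ^ a) \<noteq> 0"
proof -
  have "q ^ 10 / q ^ a = q ^ (10 - a)" using assms by (simp add: power_diff)
  moreover have "norm (q ^ 10) < 1" "norm (q ^ a) < 1" "norm (q ^ (10 - a)) < 1" 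
    using assms by (auto simp: power_less_one_iff)
  ultimately show ?thesis using assms by (simp add: mtheta_def qpoch_nonzero)
qed

text \<open>
  Since \<open>[-1] = 2 (-p;p)\<^sub>\<infinity>\<^sup>2\<close> and \<open>[q\<^sup>5][-q\<^sup>5] = (p;p\<^sup>2)\<^sub>\<infinity>\<^sup>2\<close> for \<open>p = q\<^sup>1\<^sup>0\<close>, this is the square of Euler's identity.
\<close>
lemma m10_two:
  assumes q: "0 < q" "q < 1"
  shows "m10 q (- 1) * m10 q (- (q ^ 5)) * m10 q (q ^ 5) = 2"
proof -
  define p where "p = q ^ 10"
  have p: "0 < p" "p < 1" "norm p < 1" using q by (auto simp: p_def power_less_one_iff)
  have e: "p / q ^ 5 = q ^ 5" "p / - (q ^ 5) = - (q ^ 5)" "(q ^ 5)\<^sup>2 = p" "p / - 1 = - p"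
    unfolding p_def using q power_diff[of q 5 10] by (simp_all flip: power_mult)
  have "m10 q (- 1) * m10 q (- (q ^ 5)) * m10 q (q ^ 5)
     = (qpochhammer_inf (- 1) p * qpochhammer_inf (- p) p) * (qpochhammer_inf (q ^ 5) p * qpochhammer_inf (- (q ^ 5)) p)\<^sup>2"
    unfolding p_def[symmetric] mtheta_def e by (simp add: power2_eq_square[of "a * b" for a b] mult_ac)
  also have "\<dots> = 2 * (qpochhammer_inf (- p) p * qpochhammer_inf p (p\<^sup>2))\<^sup>2"
    using qpoch_rec[OF p(3), of "- 1"] qpoch_mult_uminus[OF p(3), of "q ^ 5"]
    by (simp add: power2_eq_square[of "qpochhammer_inf a b" for a b] power_mult_distrib flip: p_def)
  also have "\<dots> = 2" using euler_odd_distinct[OF p(1,2)] by simp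
  finally show ?thesis .
qed

text \<open>
  Multiplied by \<open>(Q;Q)\<^sub>\<infinity>\<^sup>2 (Q\<^sup>2;Q\<^sup>2)\<^sub>\<infinity>\<close>, the left-hand side is \<open>f(q, q\<^sup>4)\<^sup>2 f(-q\<^sup>4, -q\<^sup>6)\<close> in Ramanujan's notation. The
  parity splitting of the square and the two quintic splittings give four nonzero components, each a difference of two
  terms to which one of the three-term relations applies.
\<close>
theorem product_dissection:
  fixes q :: real
  assumes q: "0 < q" "q < 1"
  defines "Q \<equiv> q ^ 5"
  shows "(qpochhammer_inf (- q) (q ^ 5) * qpochhammer_inf (- (q ^ 4)) (q ^ 5))\<^sup>2
       * (qpochhammer_inf (q ^ 4) (q ^ 10) * qpochhammer_inf (q ^ 6) (q ^ 10))
     = m10 Q (- Q) * m10 Q (- (Q ^ 4)) / (m10 Q Q * m10 Q (Q ^ 2) ^ 2 * m10 Q (Q ^ 4))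
     + q * (2 / (m10 Q Q * m10 Q (Q ^ 2) ^ 2 * m10 Q (Q ^ 3) * m10 Q (Q ^ 4)))
     + q ^ 2 * (m10 Q (- Q) * m10 Q (- (Q ^ 4)) / (m10 Q Q * m10 Q (Q ^ 2) * m10 Q (Q ^ 4) ^ 2))
     + q ^ 4 * (m10 Q (- (Q ^ 2)) * m10 Q (- (Q ^ 3)) / (m10 Q (Q ^ 2) * m10 Q (Q ^ 3) * m10 Q (Q ^ 4) ^ 2))"
    (is "?G = _")
proof -
  have Q: "0 < Q" "Q < 1" using q by (auto simp: Q_def power_less_one_iff)
  \<comment> \<open>needed because \<open>f(q, q\<^sup>4)\<close> is \<open>theta (t ^ 3) (t ^ 5)\<close>\<close>
  define t where "t = sqrt q"
  have t: "0 < t" "t < 1" "t\<^sup>2 = q" using q by (auto simp: t_def)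
  have tq: "t ^ (2 * n) = q ^ n" for n by (simp add: power_mult t)
  have r: "0 < t ^ 5" "t ^ 5 < 1" "(t ^ 5)\<^sup>2 = Q"
    using t tq[of 5] by (auto simp: power_less_one_iff Q_def simp flip: power_mult)
  define L where "L = qpochhammer_inf (Q\<^sup>2) (Q\<^sup>2)"
  define K where "K = qpochhammer_inf (Q ^ 10) (Q ^ 10)"
  define E where "E = qpochhammer_inf Q Q"
  have K: "K \<noteq> 0" and L: "L \<noteq> 0"
    unfolding K_def L_def by (rule qpoch_nonzero; use Q in \<open>simp add: power_less_one_iff\<close>)+
  have f1: "theta (t ^ 3) (t ^ 5) = qpochhammer_inf (- q) Q * qpochhammer_inf (- (q ^ 4)) Q * E"
  proof -
    have "- (t ^ 3) * t ^ 5 = - (q ^ 4)" using tq[of 4] by (simp flip: power_add)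
    moreover have "- (t ^ 5) / t ^ 3 = - q" using t power_diff[of t 3 5] by simp
    ultimately show ?thesis using jacobi_triple_product[OF r(1,2), of "t ^ 3"] t
      unfolding r(3) E_def by simp
  qed
  have f2: "theta (- q) Q = qpochhammer_inf (q ^ 4) (q ^ 10) * qpochhammer_inf (q ^ 6) (q ^ 10) * L"
  proof -
    have "- (- q) * Q = q ^ 6" "- Q / (- q) = q ^ 4" "Q\<^sup>2 = q ^ 10"
      using q by (simp_all add: Q_def power_numeral_reduce flip: power_mult)
    then show ?thesis using jacobi_triple_product[OF Q, of "- q"] q unfolding L_def by simp
  qed
  have f1_sq: "(theta (t ^ 3) (t ^ 5))\<^sup>2 = theta (q ^ 3) Q * theta 1 Q + q * (theta (q\<^sup>2) Q * theta Q Q)"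
  proof -
    have "(theta (t ^ 3) (t ^ 5))\<^sup>2 = theta (t ^ 3 * t ^ 3) Q * theta (t ^ 3 / t ^ 3) Q
      + t ^ 3 * t ^ 5 * theta (t ^ 3 * t ^ 3 * Q) Q * theta (t ^ 3 / t ^ 3 * Q) Q"
      using theta_mult_parity[OF r(1,2), of "t ^ 3" "t ^ 3"] t unfolding r(3) by (simp add: power2_eq_square)
    moreover have "t ^ 3 * t ^ 3 = q ^ 3" "t ^ 3 * t ^ 5 = q ^ 4" using tq[of 3] tq[of 4] by (simp_all flip: power_add)
    moreover have "t ^ 3 / t ^ 3 = 1" using t by simp
    moreover have "theta (q ^ 3 * Q) Q = theta (q\<^sup>2) Q / q ^ 3"
    proof -
      have "1 / q\<^sup>2 * Q\<^sup>2 = q ^ 3 * Q" "1 / q\<^sup>2 * Q = q ^ 3" using q by (simp_all add: Q_def power_numeral_reduce)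
      then show ?thesis using theta_shift[of "1 / q\<^sup>2" Q] theta_inverse[of "q\<^sup>2" Q] q Q by simp
    qed
    ultimately show ?thesis using q by (simp add: power_numeral_reduce)
  qed
  define n where "n = m10 Q (- 1)"
  define a1 a2 a3 a4 a5 where "a1 = m10 Q (- Q)" and "a2 = m10 Q (- (Q ^ 2))" and "a3 = m10 Q (- (Q ^ 3))"
    and "a4 = m10 Q (- (Q ^ 4))" and "a5 = m10 Q (- (Q ^ 5))"
  define b1 b2 b3 b4 b5 where "b1 = m10 Q Q" and "b2 = m10 Q (Q ^ 2)" and "b3 = m10 Q (Q ^ 3)"
    and "b4 = m10 Q (Q ^ 4)" and "b5 = m10 Q (Q ^ 5)"
  note ab = n_def[symmetric] a1_def[symmetric] a2_def[symmetric] a3_def[symmetric] a4_def[symmetric] a5_def[symmetric]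
    b1_def[symmetric] b2_def[symmetric] b3_def[symmetric] b4_def[symmetric] b5_def[symmetric]
  have b: "b1 \<noteq> 0" "b2 \<noteq> 0" "b3 \<noteq> 0" "b4 \<noteq> 0" "b5 \<noteq> 0"
    using m10_nonzero[OF Q, of 1] m10_nonzero[OF Q, of 2] m10_nonzero[OF Q, of 3] m10_nonzero[OF Q, of 4] m10_nonzero[OF Q, of 5]
    by (simp_all add: b1_def b2_def b3_def b4_def b5_def)
  have I: "a1 * a3\<^sup>2 * a5 - Q * n * a2\<^sup>2 * a4 = b1 * b3\<^sup>2 * b5"
    using three_term_third_square[OF Q] unfolding ab .
  have II: "n * a2 * a4\<^sup>2 - a1\<^sup>2 * a3 * a5 = b1\<^sup>2 * b3 * b5"
    using three_term_first_square[OF Q] unfolding ab .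
  have III: "a2\<^sup>2 * a4\<^sup>2 - Q * a1\<^sup>2 * a3\<^sup>2 = b1 * b3 * b5\<^sup>2"
    using three_term_no_unit[OF Q] unfolding ab .
  have two: "n * a5 * b5 = 2" using m10_two[OF Q] unfolding ab .
  have phi: "theta 1 Q = a1\<^sup>2 * a3\<^sup>2 * a5 * L" using theta_one_eq[OF Q] unfolding ab L_def .
  have psi: "theta Q Q = n * a2\<^sup>2 * a4\<^sup>2 * L" using theta_self_eq[OF Q] unfolding ab L_def .
  have U1: "theta (q ^ 3) Q * theta (- q) Q = K\<^sup>2 * (a4 * b4 - q * Q * n * b4 - Q / q * a2 * b2 + q\<^sup>2 * a4 * b2)"
    using theta_pair_dissection_1[OF q, folded Q_def] unfolding ab K_def .
  have U2: "theta (q\<^sup>2) Q * theta (- q) Q = K\<^sup>2 * (a5 * b4 - q * Q * a1 * b2 - Q / q * a1 * b4 + Q / q\<^sup>2 * a3 * b2)"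
    using theta_pair_dissection_2[OF q, folded Q_def] unfolding ab K_def .
  have E: "E\<^sup>2 = (b1 * b2 * b3 * b4)\<^sup>2 * b5 * K\<^sup>2"
    using qpoch_self_eq_mtheta[OF Q] unfolding ab E_def K_def .
  have Qq: "Q / q = q ^ 4" "Q / q\<^sup>2 = q ^ 3" using q by (simp_all add: Q_def power_numeral_reduce)
  have "?G * (E\<^sup>2 * L) = (theta (t ^ 3) (t ^ 5))\<^sup>2 * theta (- q) Q"
    unfolding f1 f2 Q_def[symmetric] by (simp add: power_mult_distrib)
  also have "\<dots> = theta 1 Q * (theta (q ^ 3) Q * theta (- q) Q) + q * theta Q Q * (theta (q\<^sup>2) Q * theta (- q) Q)"
    unfolding f1_sq by (simp add: algebra_simps)
  \<comment> \<open>The terms are sorted by the exponent of \<open>q\<close> modulo 5, and common brackets are taken out; what remains are the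
    left-hand sides of the three-term relations.\<close>
  also have "\<dots> = K\<^sup>2 * L * (
       b4 * a1 * a4 * (a1 * a3\<^sup>2 * a5 - Q * n * a2\<^sup>2 * a4)
     + q * (b4 * n * a5 * (a2\<^sup>2 * a4\<^sup>2 - Q * a1\<^sup>2 * a3\<^sup>2))
     + q\<^sup>2 * (b2 * a1 * a4 * (a1 * a3\<^sup>2 * a5 - Q * n * a2\<^sup>2 * a4))
     + q ^ 4 * (b2 * a2 * a3 * (n * a2 * a4\<^sup>2 - a1\<^sup>2 * a3 * a5)))"
  proof -
    have qq: "q * q ^ 4 = Q" by (simp add: Q_def power_numeral_reduce)
    show ?thesis unfolding U1 U2 phi psi Qq unfolding qq[symmetric] by algebra
  qed
  also have "\<dots> = K\<^sup>2 * L * (b4 * a1 * a4 * (b1 * b3\<^sup>2 * b5) + q * (b4 * b1 * b3 * b5 * (n * a5 * b5))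
     + q\<^sup>2 * (b2 * a1 * a4 * (b1 * b3\<^sup>2 * b5)) + q ^ 4 * (b2 * a2 * a3 * (b1\<^sup>2 * b3 * b5)))"
    unfolding I II III by (simp add: power2_eq_square mult_ac)
  finally have "?G * ((b1 * b2 * b3 * b4)\<^sup>2 * b5) * (K\<^sup>2 * L) = (b4 * a1 * a4 * (b1 * b3\<^sup>2 * b5) + q * (b4 * b1 * b3 * b5 * 2)
     + q\<^sup>2 * (b2 * a1 * a4 * (b1 * b3\<^sup>2 * b5)) + q ^ 4 * (b2 * a2 * a3 * (b1\<^sup>2 * b3 * b5))) * (K\<^sup>2 * L)"
    unfolding E two by (simp only: mult_ac)
  then have "?G * ((b1 * b2 * b3 * b4)\<^sup>2 * b5) = b4 * a1 * a4 * (b1 * b3\<^sup>2 * b5) + q * (b4 * b1 * b3 * b5 * 2)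
     + q\<^sup>2 * (b2 * a1 * a4 * (b1 * b3\<^sup>2 * b5)) + q ^ 4 * (b2 * a2 * a3 * (b1\<^sup>2 * b3 * b5))"
    using K L by simp
  moreover have "(b1 * b2 * b3 * b4)\<^sup>2 * b5 \<noteq> 0" using b by simp
  ultimately have "?G = (b4 * a1 * a4 * (b1 * b3\<^sup>2 * b5) + q * (b4 * b1 * b3 * b5 * 2)
     + q\<^sup>2 * (b2 * a1 * a4 * (b1 * b3\<^sup>2 * b5)) + q ^ 4 * (b2 * a2 * a3 * (b1\<^sup>2 * b3 * b5))) / ((b1 * b2 * b3 * b4)\<^sup>2 * b5)"
    by (metis nonzero_eq_divide_eq)
  also have "\<dots> = a1 * a4 / (b1 * b2\<^sup>2 * b4) + q * (2 / (b1 * b2\<^sup>2 * b3 * b4)) + q\<^sup>2 * (a1 * a4 / (b1 * b2 * b4\<^sup>2))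
     + q ^ 4 * (a2 * a3 / (b2 * b3 * b4\<^sup>2))"
    unfolding add_divide_distrib using b by (simp add: power2_eq_square mult_ac)
  finally show ?thesis unfolding ab .
qed


section \<open>Power series with nonnegative coefficients\<close>

definition cauchy_prod :: "(nat \<Rightarrow> real) \<Rightarrow> (nat \<Rightarrow> real) \<Rightarrow> nat \<Rightarrow> real" where
  "cauchy_prod a b n = (\<Sum>i\<le>n. a i * b (n - i))"

text \<open>
  The constant term is normalised to 1, so that multiplying by such a series never decreases a
  coefficient. This is what makes the coefficients of partial products monotone.
\<close>
definition nonneg_expansion :: "(nat \<Rightarrow> real) \<Rightarrow> (real \<Rightarrow> real) \<Rightarrow> bool" where
  "nonneg_expansion c F \<longleftrightarrow> (\<forall>n. c n \<ge> 0) \<and> c 0 = 1 \<and> (\<forall>q. 0 < q \<longrightarrow> q < 1 \<longrightarrow> (\<lambda>n. c n * q ^ n) sums F q)"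

lemma cauchy_prod_ge:
  assumes "\<And>n. a n \<ge> 0" "\<And>n. b n \<ge> 0"
  shows "a i * b j \<le> cauchy_prod a b (i + j)"
  using member_le_sum[of i "{..i + j}" "\<lambda>k. a k * b (i + j - k)"] assms
  by (simp add: cauchy_prod_def)

lemma nonneg_expansion_mult:
  assumes "nonneg_expansion a F" "nonneg_expansion b G"
  shows "nonneg_expansion (cauchy_prod a b) (\<lambda>q. F q * G q)"
  unfolding nonneg_expansion_def
proof (intro conjI allI impI)
  note A = assms[unfolded nonneg_expansion_def]
  show "0 \<le> cauchy_prod a b n" for n
    using A by (auto simp: cauchy_prod_def intro!: sum_nonneg)
  show "cauchy_prod a b 0 = 1" using A by (simp add: cauchy_prod_def)
  fix q :: real assume q: "0 < q" "q < 1"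
  have a: "(\<lambda>n. a n * q ^ n) sums F q" and b: "(\<lambda>n. b n * q ^ n) sums G q" using A q by auto
  have n: "norm (a n * q ^ n) = a n * q ^ n" "norm (b n * q ^ n) = b n * q ^ n" for n
    using A q by auto
  have "(\<lambda>k. \<Sum>i\<le>k. a i * q ^ i * (b (k - i) * q ^ (k - i))) sums ((\<Sum>k. a k * q ^ k) * (\<Sum>k. b k * q ^ k))"
    by (rule Cauchy_product_sums) (use a b in \<open>auto simp only: n intro: sums_summable\<close>)
  moreover have "(\<Sum>i\<le>k. a i * q ^ i * (b (k - i) * q ^ (k - i))) = cauchy_prod a b k * q ^ k" for k
    unfolding cauchy_prod_def sum_distrib_right
  proof (intro sum.cong refl)
    fix i assume "i \<in> {..k}"
    then have "q ^ k = q ^ i * q ^ (k - i)" by (simp flip: power_add)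
    then show "a i * q ^ i * (b (k - i) * q ^ (k - i)) = a i * b (k - i) * q ^ k" by simp
  qed
  ultimately show "(\<lambda>n. cauchy_prod a b n * q ^ n) sums (F q * G q)"
    using a b by (simp add: sums_iff)
qed

lemma nonneg_expansion_one: "nonneg_expansion (\<lambda>n. if n = 0 then 1 else 0) (\<lambda>q. 1)"
  unfolding nonneg_expansion_def
proof (intro conjI allI impI)
  fix q :: real
  have "(\<lambda>n. (if n = 0 then 1 else 0) * q ^ n) = (\<lambda>n. if n = 0 then 1 else 0)" by auto
  then show "(\<lambda>n. (if n = 0 then 1 else 0) * q ^ n) sums 1"
    using sums_single[of 0 "\<lambda>_. 1::real"] by simp
qed auto

text \<open>
  The \<open>n\<close>-th coefficients increase and are bounded by a multiple of the convergent \<open>F N (1/2)\<close>, hence converge.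
  Comparison with a geometric series at a point between \<open>q\<close> and 1 dominates the sums at \<open>q\<close>.
\<close>
lemma nonneg_expansion_limit:
  assumes exp: "\<And>N. nonneg_expansion (C N) (F N)"
    and mono: "\<And>N n. C N n \<le> C (Suc N) n"
    and lim: "\<And>q. 0 < q \<Longrightarrow> q < 1 \<Longrightarrow> (\<lambda>N. F N q) \<longlonglongrightarrow> G q"
  shows "\<exists>c. nonneg_expansion c G"
proof -
  have C: "C N n \<ge> 0" "C N 0 = 1" "0 < q \<Longrightarrow> q < 1 \<Longrightarrow> (\<lambda>n. C N n * q ^ n) sums F N q" for N n q
    using exp[of N] by (auto simp: nonneg_expansion_def)
  have bound: "\<exists>B. \<forall>N n. C N n * q ^ n \<le> B" if q: "0 < q" "q < 1" for q
  proof -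
    obtain B where B: "\<And>N. norm (F N q) \<le> B"
      using convergent_imp_Bseq[OF convergentI[OF lim[OF q]]] by (auto simp: Bseq_def)
    have "C N n * q ^ n \<le> B" for N n
    proof -
      have "(\<Sum>k\<in>{n}. C N k * q ^ k) \<le> (\<Sum>k. C N k * q ^ k)"
        by (rule sum_le_suminf) (use C(1) q sums_summable[OF C(3)[OF q]] in auto)
      also have "\<dots> = F N q" using C(3)[OF q] by (rule sums_unique[symmetric])
      also have "\<dots> \<le> B" using B[of N] by simp
      finally show ?thesis by simp
    qed
    then show ?thesis by blast
  qed
  have "convergent (\<lambda>N. C N n)" for n
  proof (rule Bseq_mono_convergent)
    obtain B where B: "\<And>N. C N n * (1/2) ^ n \<le> B" using bound[of "1/2"] by auto
    show "Bseq (\<lambda>N. C N n)"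
      by (rule BseqI'[of _ "B * 2 ^ n"]) (use B C(1) in \<open>auto simp: field_simps\<close>)
    show "\<forall>m k. m \<le> k \<longrightarrow> C m n \<le> C k n"
      using mono by (auto intro: lift_Suc_mono_le)
  qed
  then obtain c where c: "\<And>n. (\<lambda>N. C N n) \<longlonglongrightarrow> c n" unfolding convergent_def by metis
  have "nonneg_expansion c G" unfolding nonneg_expansion_def
  proof (intro conjI allI impI)
    show "0 \<le> c n" for n by (rule LIMSEQ_le_const[OF c]) (use C in auto)
    show "c 0 = 1" using LIMSEQ_unique[OF c[of 0]] C(2) by simp
    fix q :: real assume q: "0 < q" "q < 1"
    \<comment> \<open>any point between \<open>q\<close> and 1 would do\<close>
    define p where "p = (q + 1) / 2"
    have p: "0 < p" "p < 1" "q < p" using q by (auto simp: p_def)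
    obtain B where B: "\<And>N n. C N n * p ^ n \<le> B" using bound[OF p(1,2)] by blast
    have T: "eventually (\<lambda>N. summable (\<lambda>k. norm (C N k * q ^ k))) sequentially \<and>
           summable (\<lambda>n. norm (c n * q ^ n)) \<and>
           ((\<lambda>N. suminf (\<lambda>k. C N k * q ^ k)) \<longlonglongrightarrow> suminf (\<lambda>n. c n * q ^ n))"
    proof (rule tannerys_theorem)
      show "(\<lambda>N. C N k * q ^ k) \<longlonglongrightarrow> c k * q ^ k" for k by (intro tendsto_intros c)
      have "norm (C N k * q ^ k) \<le> B * (q / p) ^ k" for N k
      proof -
        have "norm (C N k * q ^ k) = C N k * p ^ k * (q / p) ^ k"
          using C(1) q p by (simp add: power_divide abs_mult)
        also have "\<dots> \<le> B * (q / p) ^ k" using B q p by (intro mult_right_mono) auto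
        finally show ?thesis .
      qed
      then show "\<forall>\<^sub>F (k, N) in sequentially \<times>\<^sub>F sequentially. norm (C N k * q ^ k) \<le> B * (q / p) ^ k"
        by (intro always_eventually) auto
      show "summable (\<lambda>k. B * (q / p) ^ k)" using p q by (intro summable_mult summable_geometric) auto
    qed auto
    have "(\<lambda>N. suminf (\<lambda>k. C N k * q ^ k)) = (\<lambda>N. F N q)"
      using C(3)[OF q] by (auto simp: sums_iff)
    then have "(\<lambda>N. F N q) \<longlonglongrightarrow> suminf (\<lambda>n. c n * q ^ n)" using T by simp
    then have "suminf (\<lambda>n. c n * q ^ n) = G q" by (rule LIMSEQ_unique[OF _ lim[OF q]])
    moreover have "summable (\<lambda>n. c n * q ^ n)" by (rule summable_norm_cancel) (use T in blast)
    ultimately show "(\<lambda>n. c n * q ^ n) sums G q" by (simp add: sums_iff)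
  qed
  then show ?thesis by blast
qed

lemma nonneg_expansion_prod:
  assumes H: "\<And>k. nonneg_expansion (h k) (H k)"
    and lim: "\<And>q. 0 < q \<Longrightarrow> q < 1 \<Longrightarrow> (\<lambda>N. \<Prod>k<N. H k q) \<longlonglongrightarrow> G q"
  shows "\<exists>c. nonneg_expansion c G"
proof -
  define C where "C = rec_nat (\<lambda>n::nat. if n = 0 then 1 else 0) (\<lambda>N c. cauchy_prod c (h N))"
  have exp: "nonneg_expansion (C N) (\<lambda>q. \<Prod>k<N. H k q)" for N
    by (induction N) (auto simp: C_def nonneg_expansion_one intro!: nonneg_expansion_mult H)
  show ?thesis
  proof (rule nonneg_expansion_limit[OF exp _ lim])
    fix N n
    have "C N n * h N 0 \<le> cauchy_prod (C N) (h N) (n + 0)"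
      by (rule cauchy_prod_ge) (use exp[of N] H[of N] in \<open>auto simp: nonneg_expansion_def\<close>)
    then show "C N n \<le> C (Suc N) n" using H[of N] by (simp add: C_def nonneg_expansion_def)
  qed
qed

lemma nonneg_expansion_binomial:
  assumes "a > 0"
  shows "nonneg_expansion (\<lambda>n. if n = 0 \<or> n = a then 1 else 0) (\<lambda>q. 1 + q ^ a)"
  unfolding nonneg_expansion_def
proof (intro conjI allI impI)
  fix q :: real
  have "(\<lambda>n. (if n = 0 \<or> n = a then 1 else 0) * q ^ n) sums (\<Sum>n\<in>{0, a}. (if n = 0 \<or> n = a then 1 else 0) * q ^ n)"
    by (rule sums_finite) auto
  then show "(\<lambda>n. (if n = 0 \<or> n = a then 1 else 0) * q ^ n) sums (1 + q ^ a)"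
    using assms by simp
qed auto

lemma nonneg_expansion_geometric:
  assumes "a > 0"
  shows "nonneg_expansion (\<lambda>n. if a dvd n then 1 else 0) (\<lambda>q. 1 / (1 - q ^ a))"
  unfolding nonneg_expansion_def
proof (intro conjI allI impI)
  fix q :: real assume q: "0 < q" "q < 1"
  have "(\<lambda>n. (q ^ a) ^ n) sums (1 / (1 - q ^ a))"
    using geometric_sums[of "q ^ a"] q assms by (simp add: power_less_one_iff)
  moreover have "(\<lambda>n. (\<lambda>n. (if a dvd n then 1 else 0) * q ^ n) (a * n)) sums (1 / (1 - q ^ a)) \<longleftrightarrow>
      (\<lambda>n. (if a dvd n then 1 else 0) * q ^ n) sums (1 / (1 - q ^ a))"
    using assms by (intro sums_mono_reindex[of "\<lambda>n. a * n"]) (auto simp: strict_mono_def)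
  ultimately show "(\<lambda>n. (if a dvd n then 1 else 0) * q ^ n) sums (1 / (1 - q ^ a))"
    by (simp add: power_mult)
qed auto

text \<open>
  Recording the set of exponents with positive coefficient lets positivity be tracked through products: it is enough
  to know these sets for the factors and to add them.
\<close>
definition positive_at :: "nat set \<Rightarrow> (real \<Rightarrow> real) \<Rightarrow> bool" where
  "positive_at A F \<longleftrightarrow> (\<exists>c. nonneg_expansion c F \<and> (\<forall>n\<in>A. c n > 0))"

lemma positive_at_zero: "nonneg_expansion c F \<Longrightarrow> positive_at {0} F"
  unfolding positive_at_def by (auto simp: nonneg_expansion_def)

lemma positive_at_mult:
  assumes "positive_at A F" "positive_at B G" "\<And>n. n \<in> N \<Longrightarrow> \<exists>i\<in>A. \<exists>j\<in>B. n = i + j"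
  shows "positive_at N (\<lambda>q. F q * G q)"
proof -
  obtain a b where a: "nonneg_expansion a F" "\<forall>n\<in>A. a n > 0" and b: "nonneg_expansion b G" "\<forall>n\<in>B. b n > 0"
    using assms unfolding positive_at_def by blast
  have "cauchy_prod a b n > 0" if n: "n \<in> N" for n
  proof -
    obtain i j where ij: "i \<in> A" "j \<in> B" "n = i + j" using assms(3)[OF n] by blast
    have "0 < a i * b j" using a b ij by simp
    also have "\<dots> \<le> cauchy_prod a b n"
      unfolding ij(3) by (rule cauchy_prod_ge) (use a b in \<open>auto simp: nonneg_expansion_def\<close>)
    finally show ?thesis .
  qed
  then show ?thesis using nonneg_expansion_mult[OF a(1) b(1)] unfolding positive_at_def by blast
qed

lemma positive_at_cong:
  assumes "positive_at A F" "\<And>q. 0 < q \<Longrightarrow> q < 1 \<Longrightarrow> F q = G q"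
  shows "positive_at A G"
proof -
  obtain c where c: "nonneg_expansion c F" "\<forall>n\<in>A. c n > 0"
    using assms(1) unfolding positive_at_def by blast
  have "nonneg_expansion c G" unfolding nonneg_expansion_def
  proof (intro conjI allI impI)
    fix q :: real assume q: "0 < q" "q < 1"
    then have "(\<lambda>n. c n * q ^ n) sums F q" using c(1) by (simp add: nonneg_expansion_def)
    then show "(\<lambda>n. c n * q ^ n) sums G q" by (simp only: assms(2)[OF q])
  qed (use c(1) in \<open>auto simp: nonneg_expansion_def\<close>)
  with c(2) show ?thesis unfolding positive_at_def by blast
qed

lemma positive_at_qpoch_neg:
  assumes "a > 0" "b > 0"
  shows "positive_at {0} (\<lambda>q. qpochhammer_inf (- (q ^ a)) (q ^ b))"
proof -
  have "\<exists>c. nonneg_expansion c (\<lambda>q. qpochhammer_inf (- (q ^ a)) (q ^ b))"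
  proof (rule nonneg_expansion_prod)
    show "nonneg_expansion (\<lambda>n. if n = 0 \<or> n = a + b * k then 1 else 0) (\<lambda>q. 1 + q ^ (a + b * k))" for k
      by (rule nonneg_expansion_binomial) (use assms in auto)
    fix q :: real assume q: "0 < q" "q < 1"
    show "(\<lambda>N. \<Prod>k<N. 1 + q ^ (a + b * k)) \<longlonglongrightarrow> qpochhammer_inf (- (q ^ a)) (q ^ b)"
      using LIMSEQ_qpoch[of "q ^ b" "- (q ^ a)"] assms q
      by (simp add: power_less_one_iff power_add power_mult)
  qed
  then show ?thesis using positive_at_zero by blast
qed

text \<open>
  The factor \<open>1/(1 - q\<^sup>a)\<close> supplies the multiples of \<open>a\<close>; all others have constant term 1 and
  nonnegative coefficients.
\<close>
lemma positive_at_inverse_qpoch: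
  assumes "a > 0" "b > 0"
  shows "positive_at {n. a dvd n} (\<lambda>q. 1 / qpochhammer_inf (q ^ a) (q ^ b))"
proof -
  have "\<exists>c. nonneg_expansion c (\<lambda>q. 1 / qpochhammer_inf (q ^ (a + b)) (q ^ b))"
  proof (rule nonneg_expansion_prod)
    show "nonneg_expansion (\<lambda>n. if (a + b + b * k) dvd n then 1 else 0) (\<lambda>q. 1 / (1 - q ^ (a + b + b * k)))" for k
      by (rule nonneg_expansion_geometric) (use assms in auto)
    fix q :: real assume q: "0 < q" "q < 1"
    have "q ^ (a + b) < 1" using assms q by (subst power_less_one_iff) auto
    then have "(\<lambda>N. 1 / (\<Prod>k<N. 1 - q ^ (a + b + b * k))) \<longlonglongrightarrow> 1 / qpochhammer_inf (q ^ (a + b)) (q ^ b)"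
      using LIMSEQ_qpoch[of "q ^ b" "q ^ (a + b)"] qpoch_nonzero[of "q ^ b" "q ^ (a + b)"] assms q
      by (intro tendsto_divide tendsto_const) (simp_all add: power_less_one_iff power_add power_mult)
    then show "(\<lambda>N. \<Prod>k<N. 1 / (1 - q ^ (a + b + b * k))) \<longlonglongrightarrow> 1 / qpochhammer_inf (q ^ (a + b)) (q ^ b)"
      by (simp add: prod_dividef)
  qed
  then have 1: "positive_at {0} (\<lambda>q. 1 / qpochhammer_inf (q ^ (a + b)) (q ^ b))" using positive_at_zero by blast
  have 2: "positive_at {n. a dvd n} (\<lambda>q. 1 / (1 - q ^ a))"
    unfolding positive_at_def by (rule exI, rule conjI, rule nonneg_expansion_geometric[OF assms(1)]) auto
  have "positive_at {n. a dvd n} (\<lambda>q. 1 / (1 - q ^ a) * (1 / qpochhammer_inf (q ^ (a + b)) (q ^ b)))"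
    by (rule positive_at_mult[OF 2 1]) auto
  then show ?thesis
  proof (rule positive_at_cong)
    fix q :: real assume q: "0 < q" "q < 1"
    then have "norm (q ^ b) < 1" using assms by (simp add: power_less_one_iff)
    from qpoch_rec[OF this, of "q ^ a"]
    show "1 / (1 - q ^ a) * (1 / qpochhammer_inf (q ^ (a + b)) (q ^ b)) = 1 / qpochhammer_inf (q ^ a) (q ^ b)"
      by (simp add: power_add)
  qed
qed

text \<open>
  A one-sided neighbourhood of 0 suffices: the first nonzero coefficient of the difference would be the limit of
  a vanishing function from the right.
\<close>
lemma power_series_unique:
  fixes a b :: "nat \<Rightarrow> real"
  assumes "\<And>q. 0 < q \<Longrightarrow> q < 1 \<Longrightarrow> (\<lambda>n. a n * q ^ n) sums F q"
    and "\<And>q. 0 < q \<Longrightarrow> q < 1 \<Longrightarrow> (\<lambda>n. b n * q ^ n) sums F q"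
  shows "a = b"
proof (rule ext)
  define d where "d n = a n - b n" for n
  have d: "(\<lambda>n. d n * q ^ n) sums 0" if "0 < q" "q < 1" for q
  proof -
    have "(\<lambda>n. a n * q ^ n - b n * q ^ n) sums (F q - F q)"
      by (intro sums_diff assms that)
    then show ?thesis by (simp add: d_def left_diff_distrib)
  qed
  fix n
  have "d n = 0"
  proof (induction n rule: less_induct)
    case (less n)
    have s: "(\<lambda>k. d (k + n) * q ^ k) sums 0" if q: "0 < q" "q < 1" for q
    proof -
      have "(\<lambda>k. d (k + n) * q ^ (k + n)) sums 0"
        using d[OF q] less sums_zero_iff_shift[of n "\<lambda>k. d k * q ^ k" 0] by simp
      then have "(\<lambda>k. d (k + n) * q ^ (k + n) / q ^ n) sums (0 / q ^ n)" by (rule sums_divide)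
      then show ?thesis using q by (simp add: power_add)
    qed
    have "((\<lambda>x. \<Sum>k. d (k + n) * x ^ k) \<longlongrightarrow> d (0 + n)) (at 0)"
    proof (rule powser_limit_0[of "1/2"])
      fix x :: real assume x: "norm x < 1/2"
      have "summable (\<lambda>k. d (k + n) * x ^ k)"
        by (rule powser_inside[of _ "1/2"]) (use s[of "1/2"] x in \<open>auto intro: sums_summable\<close>)
      then show "(\<lambda>k. d (k + n) * x ^ k) sums (\<Sum>k. d (k + n) * x ^ k)" by (rule summable_sums)
    qed auto
    then have "((\<lambda>x. \<Sum>k. d (k + n) * x ^ k) \<longlongrightarrow> d (0 + n)) (at_right 0)"
      by (rule tendsto_within_subset) simp
    moreover have "eventually (\<lambda>x. (\<Sum>k. d (k + n) * x ^ k) = 0) (at_right 0)"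
    proof -
      have "(\<Sum>k. d (k + n) * x ^ k) = 0" if "0 < x" "x < 1" for x
        using s[OF that] by (rule sums_unique[symmetric])
      then show ?thesis unfolding eventually_at_right_field by (intro exI[of _ 1]) simp
    qed
    ultimately have "((\<lambda>x::real. 0) \<longlongrightarrow> d (0 + n)) (at_right 0)" by (rule Lim_transform_eventually)
    then show "d n = 0" by (simp add: tendsto_const_iff)
  qed
  then show "a n = b n" by (simp add: d_def)
qed

section \<open>Positivity of the coefficients\<close>

lemma positive_at_m10:
  assumes "0 < a" "a < 10"
  shows "positive_at {0} (\<lambda>q. m10 q (- (q ^ a)))"
    and "positive_at {n. a dvd n} (\<lambda>q. 1 / m10 q (q ^ a))"
proof -
  have e: "q ^ 10 / q ^ a = q ^ (10 - a)" if "0 < q" for q :: real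
    using assms that by (simp add: power_diff)
  have "positive_at {0} (\<lambda>q. qpochhammer_inf (- (q ^ a)) (q ^ 10) * qpochhammer_inf (- (q ^ (10 - a))) (q ^ 10))"
    by (rule positive_at_mult[OF positive_at_qpoch_neg positive_at_qpoch_neg]) (use assms in auto)
  then show "positive_at {0} (\<lambda>q. m10 q (- (q ^ a)))"
    by (rule positive_at_cong) (simp add: mtheta_def e)
  have "positive_at {n. a dvd n} (\<lambda>q. 1 / qpochhammer_inf (q ^ a) (q ^ 10) * (1 / qpochhammer_inf (q ^ (10 - a)) (q ^ 10)))"
    by (rule positive_at_mult[OF positive_at_inverse_qpoch positive_at_inverse_qpoch]) (use assms in auto)
  then show "positive_at {n. a dvd n} (\<lambda>q. 1 / m10 q (q ^ a))"
    by (rule positive_at_cong) (simp add: mtheta_def e)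
qed

text \<open>
  The factor that decides the positivity is placed first; all other factors have constant term 1. It is
  \<open>1/[q]\<close> in the first three cases and \<open>1/([q\<^sup>2][q\<^sup>3])\<close> in the last one.
\<close>
lemma positive_at_components:
  "positive_at UNIV (\<lambda>q. m10 q (- q) * m10 q (- (q ^ 4)) / (m10 q q * m10 q (q ^ 2) ^ 2 * m10 q (q ^ 4)))"
  "positive_at UNIV (\<lambda>q. 1 / (m10 q q * m10 q (q ^ 2) ^ 2 * m10 q (q ^ 3) * m10 q (q ^ 4)))"
  "positive_at UNIV (\<lambda>q. m10 q (- q) * m10 q (- (q ^ 4)) / (m10 q q * m10 q (q ^ 2) * m10 q (q ^ 4) ^ 2))"
  "positive_at {n. n \<noteq> 1} (\<lambda>q. m10 q (- (q ^ 2)) * m10 q (- (q ^ 3)) / (m10 q (q ^ 2) * m10 q (q ^ 3) * m10 q (q ^ 4) ^ 2))"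
proof -
  have a1: "positive_at {0} (\<lambda>q. m10 q (- q))" using positive_at_m10(1)[of 1] by simp
  have b1: "positive_at UNIV (\<lambda>q. 1 / m10 q q)" using positive_at_m10(2)[of 1] by simp
  have a: "positive_at {0} (\<lambda>q. m10 q (- (q ^ 2)))" "positive_at {0} (\<lambda>q. m10 q (- (q ^ 3)))" "positive_at {0} (\<lambda>q. m10 q (- (q ^ 4)))"
    by (intro positive_at_m10; simp)+
  have b: "positive_at {n. 2 dvd n} (\<lambda>q. 1 / m10 q (q ^ 2))" "positive_at {n. 3 dvd n} (\<lambda>q. 1 / m10 q (q ^ 3))"
    "positive_at {n. 4 dvd n} (\<lambda>q. 1 / m10 q (q ^ 4))"
    by (intro positive_at_m10; simp)+
  have mono: "positive_at A (\<lambda>q. F q * G q)" if "positive_at A F" "positive_at B G" "0 \<in> B" for A B F G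
    by (rule positive_at_mult[OF that(1,2)]) (use that(3) in force)
  have "positive_at UNIV (\<lambda>q. 1 / m10 q q * (1 / m10 q (q ^ 2)) * (1 / m10 q (q ^ 2)) * (1 / m10 q (q ^ 4)) * m10 q (- q) * m10 q (- (q ^ 4)))"
    by (intro mono[OF _ a1] mono[OF _ a(3)] mono[OF _ b(3)] mono[OF _ b(1)] b1) auto
  then show "positive_at UNIV (\<lambda>q. m10 q (- q) * m10 q (- (q ^ 4)) / (m10 q q * m10 q (q ^ 2) ^ 2 * m10 q (q ^ 4)))"
    by (rule positive_at_cong) (simp add: power2_eq_square[of "m10 a b" for a b] mult_ac)
  have "positive_at UNIV (\<lambda>q. 1 / m10 q q * (1 / m10 q (q ^ 2)) * (1 / m10 q (q ^ 2)) * (1 / m10 q (q ^ 3)) * (1 / m10 q (q ^ 4)))"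
    by (intro mono[OF _ b(2)] mono[OF _ b(3)] mono[OF _ b(1)] b1) auto
  then show "positive_at UNIV (\<lambda>q. 1 / (m10 q q * m10 q (q ^ 2) ^ 2 * m10 q (q ^ 3) * m10 q (q ^ 4)))"
    by (rule positive_at_cong) (simp add: power2_eq_square[of "m10 a b" for a b] mult_ac)
  have "positive_at UNIV (\<lambda>q. 1 / m10 q q * (1 / m10 q (q ^ 2)) * (1 / m10 q (q ^ 4)) * (1 / m10 q (q ^ 4)) * m10 q (- q) * m10 q (- (q ^ 4)))"
    by (intro mono[OF _ a1] mono[OF _ a(3)] mono[OF _ b(3)] mono[OF _ b(1)] b1) auto
  then show "positive_at UNIV (\<lambda>q. m10 q (- q) * m10 q (- (q ^ 4)) / (m10 q q * m10 q (q ^ 2) * m10 q (q ^ 4) ^ 2))"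
    by (rule positive_at_cong) (simp add: power2_eq_square[of "m10 a b" for a b] mult_ac)
  have "positive_at {n. n \<noteq> 1} (\<lambda>q. 1 / m10 q (q ^ 2) * (1 / m10 q (q ^ 3)))"
  proof (rule positive_at_mult[OF b(1,2)])
    fix n :: nat assume n: "n \<in> {n. n \<noteq> 1}"
    show "\<exists>i\<in>{n. 2 dvd n}. \<exists>j\<in>{n. 3 dvd n}. n = i + j"
    proof (cases "even n")
      case True
      then show ?thesis by (intro bexI[of _ n] bexI[of _ 0]) auto
    next
      case False
      \<comment> \<open>an odd \<open>n\<close> other than 1 is \<open>(n - 3) + 3\<close>\<close>
      then have "n \<ge> 3" "even (n - 3)" using n by (auto elim!: oddE)
      then show ?thesis by (intro bexI[of _ "n - 3"] bexI[of _ 3]) auto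
    qed
  qed
  then have "positive_at {n. n \<noteq> 1} (\<lambda>q. 1 / m10 q (q ^ 2) * (1 / m10 q (q ^ 3)) * (1 / m10 q (q ^ 4)) * (1 / m10 q (q ^ 4)) * m10 q (- (q ^ 2)) * m10 q (- (q ^ 3)))"
    by (intro mono[OF _ a(1)] mono[OF _ a(2)] mono[OF _ b(3)]) auto
  then show "positive_at {n. n \<noteq> 1} (\<lambda>q. m10 q (- (q ^ 2)) * m10 q (- (q ^ 3)) / (m10 q (q ^ 2) * m10 q (q ^ 3) * m10 q (q ^ 4) ^ 2))"
    by (rule positive_at_cong) (simp add: power2_eq_square[of "m10 a b" for a b] mult_ac)
qed

lemma sums_residue_class:
  fixes c :: "nat \<Rightarrow> real"
  assumes "(\<lambda>n. c n * (q ^ 5) ^ n) sums S" "r < 5"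
  shows "(\<lambda>n. if n mod 5 = r then c (n div 5) * q ^ n else 0) sums (q ^ r * S)"
proof -
  let ?f = "\<lambda>n. if n mod 5 = r then c (n div 5) * q ^ n else 0"
  have "(\<lambda>n. q ^ r * (c n * (q ^ 5) ^ n)) sums (q ^ r * S)" using assms(1) by (rule sums_mult)
  also have "(\<lambda>n. q ^ r * (c n * (q ^ 5) ^ n)) = (\<lambda>n. ?f (5 * n + r))"
    using assms(2) by (simp add: power_add mult_ac flip: power_mult)
  finally have sums: "(\<lambda>n. ?f (5 * n + r)) sums (q ^ r * S)" .
  have "(\<lambda>n. ?f (5 * n + r)) sums (q ^ r * S) \<longleftrightarrow> ?f sums (q ^ r * S)"
  proof (rule sums_mono_reindex[of "\<lambda>n. 5 * n + r" ?f])
    show "strict_mono (\<lambda>n. 5 * n + r)" by (auto simp: strict_mono_def)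
    fix n assume n: "n \<notin> range (\<lambda>n. 5 * n + r)"
    have "n = 5 * (n div 5) + n mod 5" by simp
    with n have "n mod 5 \<noteq> r" by (metis rangeI)
    then show "?f n = 0" by simp
  qed
  with sums show ?thesis by (rule iffD1[rotated])
qed

theorem corollary1p3:
  fixes g1 :: "nat \<Rightarrow> real"
  assumes g1: "\<And>q :: complex. norm q < 1 \<Longrightarrow>
    (\<lambda>n. of_real (g1 n) * q ^ n) sums
      ((qpochhammer_infs [- q, - (q ^ 4)] (q ^ 5))\<^sup>2 * qpochhammer_infs [q ^ 4, q ^ 6] (q ^ 10))"
  shows "\<forall>n. g1 (5 * n) > 0 \<and> g1 (5 * n + 1) > 0 \<and> g1 (5 * n + 2) > 0 \<and>
    (n \<noteq> 1 \<longrightarrow> g1 (5 * n + 4) > 0)"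
proof -
  let ?G = "\<lambda>q::real. (qpochhammer_inf (- q) (q ^ 5) * qpochhammer_inf (- (q ^ 4)) (q ^ 5))\<^sup>2
       * (qpochhammer_inf (q ^ 4) (q ^ 10) * qpochhammer_inf (q ^ 6) (q ^ 10))"
  obtain c0 c1 c2 c4 where
    c0: "nonneg_expansion c0 (\<lambda>q. m10 q (- q) * m10 q (- (q ^ 4)) / (m10 q q * m10 q (q ^ 2) ^ 2 * m10 q (q ^ 4)))"
      "\<forall>n. c0 n > 0" and
    c1: "nonneg_expansion c1 (\<lambda>q. 1 / (m10 q q * m10 q (q ^ 2) ^ 2 * m10 q (q ^ 3) * m10 q (q ^ 4)))"
      "\<forall>n. c1 n > 0" and
    c2: "nonneg_expansion c2 (\<lambda>q. m10 q (- q) * m10 q (- (q ^ 4)) / (m10 q q * m10 q (q ^ 2) * m10 q (q ^ 4) ^ 2))"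
      "\<forall>n. c2 n > 0" and
    c4: "nonneg_expansion c4 (\<lambda>q. m10 q (- (q ^ 2)) * m10 q (- (q ^ 3)) / (m10 q (q ^ 2) * m10 q (q ^ 3) * m10 q (q ^ 4) ^ 2))"
      "\<forall>n. n \<noteq> 1 \<longrightarrow> c4 n > 0"
    using positive_at_components unfolding positive_at_def by auto
  \<comment> \<open>the coefficients that the dissection predicts, with 0 in the residue class of 3\<close>
  define h where "h n = (if n mod 5 = 0 then c0 (n div 5) else 0) + (if n mod 5 = 1 then 2 * c1 (n div 5) else 0)
     + (if n mod 5 = 2 then c2 (n div 5) else 0) + (if n mod 5 = 4 then c4 (n div 5) else 0)" for n
  have h: "(\<lambda>n. h n * q ^ n) sums ?G q" if q: "0 < q" "q < 1" for q
  proof -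
    have Q: "0 < q ^ 5" "q ^ 5 < 1" using q by (auto simp: power_less_one_iff)
    note s = c0(1)[unfolded nonneg_expansion_def] c1(1)[unfolded nonneg_expansion_def]
      c2(1)[unfolded nonneg_expansion_def] c4(1)[unfolded nonneg_expansion_def]
    note e = s[THEN conjunct2, THEN conjunct2, rule_format, OF Q]
    note e1 = sums_mult[OF e(2), of 2, simplified mult.assoc[symmetric]]
    have "(\<lambda>n. (if n mod 5 = 0 then c0 (n div 5) * q ^ n else 0) + (if n mod 5 = 1 then 2 * c1 (n div 5) * q ^ n else 0)
     + (if n mod 5 = 2 then c2 (n div 5) * q ^ n else 0) + (if n mod 5 = 4 then c4 (n div 5) * q ^ n else 0)) sums ?G q"
      unfolding product_dissection[OF q]
      using sums_add[OF sums_add[OF sums_add[OF sums_residue_class[OF e(1), of 0] sums_residue_class[OF e1, of 1]]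
        sums_residue_class[OF e(3), of 2]] sums_residue_class[OF e(4), of 4]]
      by simp
    moreover have "h n * q ^ n = (if n mod 5 = 0 then c0 (n div 5) * q ^ n else 0) + (if n mod 5 = 1 then 2 * c1 (n div 5) * q ^ n else 0)
     + (if n mod 5 = 2 then c2 (n div 5) * q ^ n else 0) + (if n mod 5 = 4 then c4 (n div 5) * q ^ n else 0)" for n
      by (simp add: h_def)
    ultimately show ?thesis by simp
  qed
  have g: "(\<lambda>n. g1 n * q ^ n) sums ?G q" if q: "0 < q" "q < 1" for q
  proof -
    have n: "norm (q ^ 5) < 1" "norm (q ^ 10) < 1" "norm (complex_of_real q) < 1" using q by (auto simp: power_less_one_iff)
    note o = of_real_qpoch[OF n(1)] of_real_qpoch[OF n(2)]
    have "(qpochhammer_infs [- complex_of_real q, - (complex_of_real q ^ 4)] (complex_of_real q ^ 5))\<^sup>2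
      * qpochhammer_infs [complex_of_real q ^ 4, complex_of_real q ^ 6] (complex_of_real q ^ 10) = complex_of_real (?G q)"
      by (simp add: qpochhammer_infs_def o)
    with g1[OF n(3)] have "(\<lambda>n. complex_of_real (g1 n * q ^ n)) sums complex_of_real (?G q)" by simp
    then show ?thesis by (rule sums_of_real_iff[THEN iffD1])
  qed
  have "g1 = h" by (rule power_series_unique[OF g h])
  moreover have "h (5 * n) = c0 n \<and> h (5 * n + 1) = 2 * c1 n \<and> h (5 * n + 2) = c2 n \<and> h (5 * n + 4) = c4 n" for n
  proof -
    have m: "(5 * n + r) mod 5 = r" "(5 * n + r) div 5 = n" if "r < 5" for r using that by auto
    show ?thesis using m[of 0] m[of 1] m[of 2] m[of 4] by (simp add: h_def)
  qed
  ultimately show ?thesis using c0(2) c1(2) c2(2) c4(2) by simp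
qed

end
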